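(* Let $(M,F)$ be a connected homogeneous Finsler space of dimension $n$. Then $(M,F)$ has isotropic S-curvature, i.e. there is a function $c$ on $M$ with $S(x,y)=(n+1)c(x)F(x,y)$ for all $x\in M$ and all nonzero $y\in T_xM$, if and only if its S-curvature vanishes identically.
   Context: A Finsler metric on $M$ is a function $F:TM\setminus\{0\}\to\mathbb R^+$ that is smooth, positively homogeneous of degree $1$ on fibres, and whose fundamental tensor $\frac12[F^2]_{y^iy^j}$ (with respect to linear fibre coordinates) is positive definite at every $y\ne 0$. $(M,F)$ is homogeneous if its isometry group $I(M,F)$ (a Lie transformation group of $M$) acts transitively on $M$. S-curvature: in local coordinates $(x^i)$ on $M$ with induced fibre coordinates $y=y^i\partial_{x^i}$ and $g_{pq}=\frac12[F^2]_{y^py^q}$, the distortion is $$\tau(x,y)=\ln\frac{\sqrt{\det(g_{pq}(x,y))}}{\sigma(x)},\qquad \sigma(x)=\frac{\mathrm{Vol}(B^n)}{\mathrm{Vol}\{(y^i)\in\mathbb R^n: F(x,y^i\partial_{x^i})<1\}},$$ where $\mathrm{Vol}$ is Euclidean volume and $B^n$ is the open unit ball in $\mathbb R^n$; $\tau$ is independent of the coordinates. For $y\ne0$, $S(x,y)=\frac{d}{dt}\tau(\gamma(t),\dot\gamma(t))|_{t=0}$, where $\gamma$ is the geodesic of $F$ with $\gamma(0)=x$, $\dot\gamma(0)=y$; equivalently $S$ is the derivative of $\tau$ in the direction of the geodesic spray $y^i\partial_{x^i}-\frac12 g^{il}\big([F^2]_{x^jy^l}y^j-[F^2]_{x^l}\big)\partial_{y^i}$,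 where $(g^{ij})$ is the inverse of $(g_{ij})$ and summation over repeated indices is understood. *)

theory Defs
  imports "HOL-Analysis.Analysis"
begin

section \<open>Smooth functions\<close>

text \<open>
  A function is \<open>C\<^sup>k\<^sup>+\<^sup>1\<close> if it is differentiable and its directional derivatives along all fixed vectors
  are \<open>C\<^sup>k\<close>. To be used for open sets \<open>S\<close> only.
\<close>

fun Ck_on :: "nat \<Rightarrow> 'a::euclidean_space set \<Rightarrow> ('a \<Rightarrow> 'b::euclidean_space) \<Rightarrow> bool" where
  "Ck_on 0 S f \<longleftrightarrow> continuous_on S f"
| "Ck_on (Suc k) S f \<longleftrightarrow>
     (\<forall>x\<in>S. f differentiable (at x)) \<and>
     (\<forall>v. Ck_on k S (\<lambda>x. frechet_derivative f (at x) v))"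

definition smooth_on :: "'a::euclidean_space set \<Rightarrow> ('a \<Rightarrow> 'b::euclidean_space) \<Rightarrow> bool" where
  "smooth_on S f \<longleftrightarrow> (\<forall>k. Ck_on k S f)"

section \<open>Smooth manifolds\<close>

text \<open>
  A chart is a pair of a coordinate domain and a coordinate map, whose values outside of the
  domain are irrelevant. The dimension of the manifold is the cardinality of the index type.
\<close>

type_synonym ('a, 'n) chart = "'a set \<times> ('a \<Rightarrow> real ^ 'n)"

abbreviation chart_inv :: "('a, 'n::finite) chart \<Rightarrow> real ^ 'n \<Rightarrow> 'a" where
  "chart_inv c \<equiv> inv_into (fst c) (snd c)"

definition is_chart :: "'a topology \<Rightarrow> ('a, 'n::finite) chart \<Rightarrow> bool" where
  "is_chart X c \<longleftrightarrow> openin X (fst c) \<and> open (snd c ` fst c) \<and>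
     homeomorphic_map (subtopology X (fst c)) (top_of_set (snd c ` fst c)) (snd c)"

definition second_countable_space :: "'a topology \<Rightarrow> bool" where
  "second_countable_space X \<longleftrightarrow>
     (\<exists>\<B>. countable \<B> \<and> (\<forall>V\<in>\<B>. openin X V) \<and>
        (\<forall>U x. openin X U \<and> x \<in> U \<longrightarrow> (\<exists>V\<in>\<B>. x \<in> V \<and> V \<subseteq> U)))"

definition smooth_manifold :: "'a topology \<Rightarrow> ('a, 'n::finite) chart set \<Rightarrow> bool" where
  "smooth_manifold X A \<longleftrightarrow>
     Hausdorff_space X \<and> second_countable_space X \<and>
     (\<forall>c\<in>A. is_chart X c) \<and> (\<Union>c\<in>A. fst c) = topspace X \<and>
     (\<forall>c\<in>A. \<forall>d\<in>A. smooth_on (snd c ` (fst c \<inter> fst d)) (snd d \<circ> chart_inv c))"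

definition charts_at :: "('a, 'n::finite) chart set \<Rightarrow> 'a \<Rightarrow> ('a, 'n) chart set" where
  "charts_at A p = {c \<in> A. p \<in> fst c}"

text \<open>
  A tangent vector at \<open>p\<close> is the family of its coordinate vectors in all charts of the atlas around
  \<open>p\<close>, related by the Jacobians of the coordinate changes (and set to \<open>0\<close> for the other charts).
  The vector space structure is pointwise.
\<close>

type_synonym ('a, 'n) tangent = "('a, 'n) chart \<Rightarrow> real ^ 'n"

definition tangent_space ::
    "('a, 'n::finite) chart set \<Rightarrow> 'a \<Rightarrow> ('a, 'n) tangent set" where
  "tangent_space A p = {v.
     (\<forall>c\<in>charts_at A p. \<forall>d\<in>charts_at A p.
        v d = frechet_derivative (snd d \<circ> chart_inv c) (at (snd c p)) (v c)) \<and>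
     (\<forall>c. c \<notin> charts_at A p \<longrightarrow> v c = 0)}"

text \<open>The tangent vector \<open>y\<^sup>i \<partial>/\<partial>x\<^sup>i\<close> at \<open>p\<close>, where \<open>(x\<^sup>i)\<close> are the coordinates of the chart \<open>c\<close>.\<close>

definition coord_vector ::
    "('a, 'n::finite) chart set \<Rightarrow> ('a, 'n) chart \<Rightarrow> 'a \<Rightarrow> real ^ 'n \<Rightarrow> ('a, 'n) tangent" where
  "coord_vector A c p y = (\<lambda>d. if d \<in> charts_at A p
     then frechet_derivative (snd d \<circ> chart_inv c) (at (snd c p)) y else 0)"

text \<open>
  An arbitrary chart around \<open>p\<close>. It is only used to evaluate expressions that do not depend on the
  choice of local coordinates.
\<close>

definition chart_at :: "('a, 'n::finite) chart set \<Rightarrow> 'a \<Rightarrow> ('a, 'n) chart" where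
  "chart_at A p = (SOME c. c \<in> charts_at A p)"

definition smooth_map :: "('a, 'n::finite) chart set \<Rightarrow> ('a \<Rightarrow> 'a) \<Rightarrow> bool" where
  "smooth_map A f \<longleftrightarrow>
     (\<forall>c\<in>A. \<forall>d\<in>A. smooth_on (snd c ` {p \<in> fst c. f p \<in> fst d}) (snd d \<circ> f \<circ> chart_inv c))"

definition diffeomorphism ::
    "'a topology \<Rightarrow> ('a, 'n::finite) chart set \<Rightarrow> ('a \<Rightarrow> 'a) \<Rightarrow> bool" where
  "diffeomorphism X A f \<longleftrightarrow>
     homeomorphic_map X X f \<and> smooth_map A f \<and> smooth_map A (inv_into (topspace X) f)"

definition differential ::
    "('a, 'n::finite) chart set \<Rightarrow> ('a \<Rightarrow> 'a) \<Rightarrow> 'a \<Rightarrow> ('a, 'n) tangent \<Rightarrow> ('a, 'n) tangent" where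
  "differential A f p v = (\<lambda>d. if d \<in> charts_at A (f p)
     then (let c = chart_at A p
           in frechet_derivative (snd d \<circ> f \<circ> chart_inv c) (at (snd c p)) (v c))
     else 0)"

section \<open>Finsler metrics\<close>

text \<open>
  The representation of a Finsler metric in the coordinates \<open>(x, y)\<close> that a chart \<open>c\<close> induces on the
  tangent bundle.
\<close>

definition local_F ::
    "('a, 'n::finite) chart set \<Rightarrow> ('a \<Rightarrow> ('a, 'n) tangent \<Rightarrow> real) \<Rightarrow> ('a, 'n) chart
      \<Rightarrow> (real ^ 'n) \<times> (real ^ 'n) \<Rightarrow> real" where
  "local_F A F c = (\<lambda>(x, y). F (chart_inv c x) (coord_vector A c (chart_inv c x) y))"

definition local_F2 ::
    "('a, 'n::finite) chart set \<Rightarrow> ('a \<Rightarrow> ('a, 'n) tangent \<Rightarrow> real) \<Rightarrow> ('a, 'n) chart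
      \<Rightarrow> (real ^ 'n) \<times> (real ^ 'n) \<Rightarrow> real" where
  "local_F2 A F c z = (local_F A F c z)\<^sup>2"

definition dx :: "'n::finite \<Rightarrow> ((real ^ 'n) \<times> (real ^ 'n) \<Rightarrow> real)
    \<Rightarrow> (real ^ 'n) \<times> (real ^ 'n) \<Rightarrow> real" where
  "dx i h z = frechet_derivative h (at z) (axis i 1, 0)"

definition dy :: "'n::finite \<Rightarrow> ((real ^ 'n) \<times> (real ^ 'n) \<Rightarrow> real)
    \<Rightarrow> (real ^ 'n) \<times> (real ^ 'n) \<Rightarrow> real" where
  "dy i h z = frechet_derivative h (at z) (0, axis i 1)"

definition fundamental_tensor ::
    "('a, 'n::finite) chart set \<Rightarrow> ('a \<Rightarrow> ('a, 'n) tangent \<Rightarrow> real) \<Rightarrow> ('a, 'n) chart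
      \<Rightarrow> (real ^ 'n) \<times> (real ^ 'n) \<Rightarrow> real ^ 'n ^ 'n" where
  "fundamental_tensor A F c z = (\<chi> i j. dy j (dy i (local_F2 A F c)) z / 2)"

text \<open>The values of \<open>F\<close> at zero vectors are irrelevant.\<close>

definition finsler_metric ::
    "'a topology \<Rightarrow> ('a, 'n::finite) chart set \<Rightarrow> ('a \<Rightarrow> ('a, 'n) tangent \<Rightarrow> real) \<Rightarrow> bool" where
  "finsler_metric X A F \<longleftrightarrow>
     (\<forall>p\<in>topspace X. \<forall>v\<in>tangent_space A p - {\<lambda>_. 0}. F p v > 0) \<and>
     (\<forall>p\<in>topspace X. \<forall>v\<in>tangent_space A p - {\<lambda>_. 0}. \<forall>r>0.
        F p (\<lambda>c. r *\<^sub>R v c) = r * F p v) \<and>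
     (\<forall>c\<in>A. smooth_on (snd c ` fst c \<times> (UNIV - {0})) (local_F A F c)) \<and>
     (\<forall>c\<in>A. \<forall>x\<in>snd c ` fst c. \<forall>y. y \<noteq> 0 \<longrightarrow>
        (\<forall>u. u \<noteq> 0 \<longrightarrow> u \<bullet> (fundamental_tensor A F c (x, y) *v u) > 0))"

definition isometry_group ::
    "'a topology \<Rightarrow> ('a, 'n::finite) chart set \<Rightarrow> ('a \<Rightarrow> ('a, 'n) tangent \<Rightarrow> real)
      \<Rightarrow> ('a \<Rightarrow> 'a) set" where
  "isometry_group X A F = {f. diffeomorphism X A f \<and>
     (\<forall>p\<in>topspace X. \<forall>v\<in>tangent_space A p - {\<lambda>_. 0}. F (f p) (differential A f p v) = F p v)}"

definition homogeneous_finsler ::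
    "'a topology \<Rightarrow> ('a, 'n::finite) chart set \<Rightarrow> ('a \<Rightarrow> ('a, 'n) tangent \<Rightarrow> real) \<Rightarrow> bool" where
  "homogeneous_finsler X A F \<longleftrightarrow>
     (\<forall>p\<in>topspace X. \<forall>q\<in>topspace X. \<exists>f\<in>isometry_group X A F. f p = q)"

section \<open>S-curvature\<close>

text \<open>The point \<open>y = 0\<close>, where \<open>F\<close> is extended by \<open>0\<close>, is put into the unit ball of \<open>F\<close>.\<close>

definition bh_density ::
    "('a, 'n::finite) chart set \<Rightarrow> ('a \<Rightarrow> ('a, 'n) tangent \<Rightarrow> real) \<Rightarrow> ('a, 'n) chart
      \<Rightarrow> real ^ 'n \<Rightarrow> real" where
  "bh_density A F c x =
     measure lebesgue (ball 0 1 :: (real ^ 'n) set) /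
     measure lebesgue {y. y = 0 \<or> local_F A F c (x, y) < 1}"

definition distortion ::
    "('a, 'n::finite) chart set \<Rightarrow> ('a \<Rightarrow> ('a, 'n) tangent \<Rightarrow> real) \<Rightarrow> ('a, 'n) chart
      \<Rightarrow> (real ^ 'n) \<times> (real ^ 'n) \<Rightarrow> real" where
  "distortion A F c z = ln (sqrt (det (fundamental_tensor A F c z)) / bh_density A F c (fst z))"

text \<open>
  The components of the geodesic spray
  \<open>y\<^sup>i \<partial>/\<partial>x\<^sup>i - 1/2 g\<^sup>i\<^sup>l ([F\<^sup>2]\<^bsub>x\<^sup>j y\<^sup>l\<^esub> y\<^sup>j - [F\<^sup>2]\<^bsub>x\<^sup>l\<^esub>) \<partial>/\<partial>y\<^sup>i\<close>.
  Its integral curves are the curves \<open>(\<gamma>, \<gamma>')\<close> for the geodesics \<open>\<gamma>\<close> of \<open>F\<close>.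
\<close>

definition geodesic_spray ::
    "('a, 'n::finite) chart set \<Rightarrow> ('a \<Rightarrow> ('a, 'n) tangent \<Rightarrow> real) \<Rightarrow> ('a, 'n) chart
      \<Rightarrow> (real ^ 'n) \<times> (real ^ 'n) \<Rightarrow> (real ^ 'n) \<times> (real ^ 'n)" where
  "geodesic_spray A F c z =
     (snd z,
      \<chi> i. - (1/2) * (\<Sum>l\<in>UNIV. matrix_inv (fundamental_tensor A F c z) $ i $ l *
        ((\<Sum>j\<in>UNIV. dx j (dy l (local_F2 A F c)) z * snd z $ j) - dx l (local_F2 A F c) z)))"

text \<open>The S-curvature is the derivative of the distortion along the geodesic spray.\<close>

definition S_curvature ::
    "('a, 'n::finite) chart set \<Rightarrow> ('a \<Rightarrow> ('a, 'n) tangent \<Rightarrow> real)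
      \<Rightarrow> 'a \<Rightarrow> ('a, 'n) tangent \<Rightarrow> real" where
  "S_curvature A F p v =
     (let c = chart_at A p; z = (snd c p, v c)
      in frechet_derivative (distortion A F c) (at z) (geodesic_spray A F c z))"

definition isotropic_S_curvature ::
    "'a topology \<Rightarrow> ('a, 'n::finite) chart set \<Rightarrow> ('a \<Rightarrow> ('a, 'n) tangent \<Rightarrow> real) \<Rightarrow> bool" where
  "isotropic_S_curvature X A F \<longleftrightarrow>
     (\<exists>\<kappa>. \<forall>p\<in>topspace X. \<forall>v\<in>tangent_space A p - {\<lambda>_. 0}.
        S_curvature A F p v = (real CARD('n) + 1) * \<kappa> p * F p v)"

definition vanishing_S_curvature ::
    "'a topology \<Rightarrow> ('a, 'n::finite) chart set \<Rightarrow> ('a \<Rightarrow> ('a, 'n) tangent \<Rightarrow> real) \<Rightarrow> bool" where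
  "vanishing_S_curvature X A F \<longleftrightarrow>
     (\<forall>p\<in>topspace X. \<forall>v\<in>tangent_space A p - {\<lambda>_. 0}. S_curvature A F p v = 0)"

end

theory Submission
  imports Defs
begin

text \<open>
  The distortion \<open>\<tau>\<close> is defined by \<open>F\<close> alone, so isometries preserve it, and since the fundamental
  tensor is invariant under positive scalings of \<open>y\<close>, so is \<open>\<tau>\<close>. On one tangent space \<open>\<tau>\<close> is therefore
  determined by its values on a compact sphere, and it attains a maximum, at \<open>(p, v)\<close> say. As every
  point is mapped to \<open>p\<close> by an isometry, no value of \<open>\<tau>\<close> anywhere on the slit tangent bundle
  exceeds \<open>\<tau>(p, v)\<close>. So \<open>(p, v)\<close> is a critical point of \<open>\<tau>\<close>, and the derivative of \<open>\<tau>\<close> along the spray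
  vanishes there, whatever the spray is: \<open>S(p, v) = 0\<close>. Hence for each \<open>p\<close> there is some \<open>v \<noteq> 0\<close> with
  \<open>S(p, v) = 0\<close> (\<open>ex_zero_S_curvature\<close>), and if \<open>S = (n + 1) c F\<close>, then \<open>F(p, v) > 0\<close> gives \<open>c(p) = 0\<close>.

  A critical point argument needs \<open>\<tau>\<close> to be differentiable. For the determinant this is clear; for the
  volume \<open>V(x)\<close> of the unit ball of \<open>F(x, \<cdot>)\<close> it is not, because the domain of integration varies with
  \<open>x\<close>. The volume of the ball of radius \<open>r\<close> is \<open>r\<^sup>n V(x)\<close>, so the images of Lebesgue measure under the
  functions \<open>F(x, \<cdot>)\<close> for different \<open>x\<close> are proportional to each other, with factors \<open>V(x)\<close>. It follows
  that \<open>V(x)\<close> is a constant multiple of \<open>\<integral> \<phi>(F(x, y)) dy\<close> for a fixed bump function \<open>\<phi>\<close>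
  (\<open>volume_proportional\<close>). For \<open>\<phi>\<close> continuously differentiable and supported in \<open>[1, 2]\<close> the integrand
  is continuously differentiable, also at \<open>y = 0\<close>, and supported in a fixed box, so that one may
  differentiate under the integral sign (\<open>volume_differentiable\<close>).

  The invariance of \<open>\<tau>\<close> is needed only between two points \<open>q\<close> and \<open>p = f(q)\<close> in the domain of a single
  chart. There the differential of \<open>f\<close> is a linear map \<open>L\<close> with \<open>F(q, y) = F(p, L y)\<close>; the determinant of
  the fundamental tensor is multiplied by \<open>(det L)\<^sup>2\<close> and the volume of the unit ball by \<open>1 / \<bar>det L\<bar>\<close>,
  and the two factors cancel in \<open>\<tau>\<close> (\<open>distortion_of_linear_isometry\<close>).
\<close>

section \<open>Linear changes of variables and determinants\<close>

text \<open>
  A box can be translated until its points have nonnegative \<open>n\<close>-th coordinates, and a linear map turns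
  translations into translations.
\<close>

lemma measure_shear_cbox:
  fixes a b :: "real ^ 'n"
  assumes "m \<noteq> n"
  shows "measure lebesgue ((\<lambda>x. \<chi> i. if i = m then x $ m + x $ n else x $ i) ` cbox a b) =
    measure lebesgue (cbox a b)" (is "measure lebesgue (?h ` _) = _")
proof (cases "cbox a b = {}")
  case False
  define w :: "real ^ 'n" where "w = (\<chi> i. \<bar>a $ n\<bar>)"
  have lin: "linear ?h"
    by (rule linearI) (auto simp: vec_eq_iff algebra_simps)
  have "?h ` cbox (w + a) (w + b) = ?h ` ((+) w ` cbox a b)"
    by (simp add: cbox_translation)
  also have "\<dots> = (+) (?h w) ` (?h ` cbox a b)"
    by (simp add: image_image linear_add[OF lin])
  finally have "measure lebesgue (?h ` cbox a b) = measure lebesgue (?h ` cbox (w + a) (w + b))"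
    by (simp only: measure_translation)
  also have "\<dots> = measure lebesgue (cbox (w + a) (w + b))"
    by (rule measure_shear_interval) (use assms False in \<open>auto simp: w_def cbox_translation\<close>)
  also have "\<dots> = measure lebesgue (cbox a b)"
    by (simp only: cbox_translation measure_translation)
  finally show ?thesis .
qed simp

lemma measure_permute_cbox:
  fixes a b :: "real ^ 'n"
  assumes p: "p permutes UNIV"
  shows "measure lebesgue ((\<lambda>x. \<chi> i. x $ p i) ` cbox a b) = measure lebesgue (cbox a b)"
    (is "measure lebesgue (?h ` _) = _")
proof (cases "cbox a b = {}")
  case False
  have "x \<in> ?h ` cbox a b" if "x \<in> cbox (?h a) (?h b)" for x
  proof (rule image_eqI)
    show "x = ?h (\<chi> i. x $ inv p i)"
      using p by (simp add: vec_eq_iff permutes_inverses)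
    show "(\<chi> i. x $ inv p i) \<in> cbox a b"
      unfolding mem_box_cart
    proof
      fix i
      show "a $ i \<le> (\<chi> i. x $ inv p i) $ i \<and> (\<chi> i. x $ inv p i) $ i \<le> b $ i"
        using that[unfolded mem_box_cart, rule_format, of "inv p i"] p
        by (simp add: permutes_inverses)
    qed
  qed
  then have eq: "?h ` cbox a b = cbox (?h a) (?h b)"
    by (auto simp: mem_box_cart)
  with False have "cbox (?h a) (?h b) \<noteq> {}"
    by auto
  then show ?thesis
    using False prod.permute[OF p, of "\<lambda>i. b $ i - a $ i"]
    by (simp add: eq content_cbox_cart o_def)
qed simp

text \<open>
  Every linear map is a composition of diagonal maps, transpositions of coordinates, shears, and maps
  into a coordinate hyperplane. For each of these both sides are known; the determinant of a shear is
  obtained from a row operation on the identity matrix.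
\<close>

lemma lmeasurable_measure_linear_image:
  fixes f :: "real ^ 'n \<Rightarrow> real ^ 'n"
  assumes "linear f" "S \<in> lmeasurable"
  shows "f ` S \<in> lmeasurable \<and> measure lebesgue (f ` S) = \<bar>det (matrix f)\<bar> * measure lebesgue S"
proof -
  define P where "P f \<longleftrightarrow> (\<forall>S\<in>lmeasurable. f ` S \<in> lmeasurable \<and>
    measure lebesgue (f ` S) = \<bar>det (matrix f)\<bar> * measure lebesgue S)" for f :: "real ^ 'n \<Rightarrow> real ^ 'n"
  have box: "P f" if "linear f" "\<bar>det (matrix f)\<bar> = 1"
    "\<And>a b. measure lebesgue (f ` cbox a b) = measure lebesgue (cbox a b)" for f
    unfolding P_def
  proof
    fix S :: "(real ^ 'n) set"
    assume "S \<in> lmeasurable"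
    with measure_linear_sufficient[of f S 1] that
    show "f ` S \<in> lmeasurable \<and> measure lebesgue (f ` S) = \<bar>det (matrix f)\<bar> * measure lebesgue S"
      by (metis mult_1)
  qed
  have "P f"
    using assms(1)
  proof (rule induct_linear_elementary)
    fix f g :: "real ^ 'n \<Rightarrow> real ^ 'n"
    assume "linear f" "linear g" "P f" "P g"
    then show "P (f \<circ> g)"
      unfolding P_def image_comp[symmetric] by (simp add: matrix_compose det_mul abs_mult)
  next
    fix f :: "real ^ 'n \<Rightarrow> real ^ 'n" and i
    assume f: "linear f" and 0: "\<And>x. f x $ i = 0"
    have "\<not> surj f"
      using 0 by (metis axis_nth surjE zero_neq_one)
    then have inj: "\<not> inj f"
      using f linear_injective_imp_surjective by blast
    then have "det (matrix f) = 0"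
      using f det_nz_iff_inj by blast
    moreover have "negligible (f ` S)" for S
      using negligible_linear_singular_image[OF f inj] .
    ultimately show "P f"
      by (simp add: P_def negligible_imp_measurable negligible_imp_measure0)
  next
    fix c :: "'n \<Rightarrow> real"
    have "det (matrix (\<lambda>x. \<chi> i. c i * x $ i) :: real ^ 'n ^ 'n) = prod c UNIV"
      by (subst det_diagonal) (auto simp: matrix_def axis_def)
    then show "P (\<lambda>x. \<chi> i. c i * x $ i)"
      by (simp add: P_def measurable_stretch measure_stretch)
  next
    fix m n :: 'n
    assume "m \<noteq> n"
    let ?p = "Transposition.transpose m n"
    let ?h = "\<lambda>x :: real ^ 'n. \<chi> i. x $ ?p i"
    have p: "?p permutes UNIV"
      by (simp add: permutes_swap_id)
    have "matrix ?h = (\<chi> i. (mat 1 :: real ^ 'n ^ 'n) $ ?p i)"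
      by (auto simp: matrix_def mat_def axis_def vec_eq_iff)
    then have "\<bar>det (matrix ?h)\<bar> = 1"
      using det_permute_rows[OF p, of "mat 1 :: real ^ 'n ^ 'n"] \<open>m \<noteq> n\<close>
      by (simp add: sign_swap_id)
    then show "P ?h"
      by (intro box measure_permute_cbox p) (auto intro!: linearI simp: vec_eq_iff)
  next
    fix m n :: 'n
    assume mn: "m \<noteq> n"
    let ?h = "\<lambda>x :: real ^ 'n. \<chi> i. if i = m then x $ m + x $ n else x $ i"
    have "matrix ?h = (\<chi> k. if k = m then row m (mat 1 :: real ^ 'n ^ 'n) + 1 *s row n (mat 1)
        else row k (mat 1))"
      by (auto simp: matrix_def mat_def axis_def vec_eq_iff row_def)
    then have "\<bar>det (matrix ?h)\<bar> = 1"
      using det_row_operation[OF mn, of "mat 1 :: real ^ 'n ^ 'n" 1] by simp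
    then show "P ?h"
      by (intro box measure_shear_cbox mn) (auto intro!: linearI simp: vec_eq_iff algebra_simps)
  qed
  then show ?thesis
    using assms(2) by (simp add: P_def)
qed

text \<open>
  The segment from the identity to \<open>M\<close> consists of positive definite, hence invertible matrices, so
  that the determinant does not change its sign along it.
\<close>

lemma det_pos_if_positive_definite:
  fixes M :: "real ^ 'n ^ 'n"
  assumes "\<And>u. u \<noteq> 0 \<Longrightarrow> u \<bullet> (M *v u) > 0"
  shows "det M > 0"
proof (rule ccontr)
  assume "\<not> det M > 0"
  define G where "G t = t *\<^sub>R M + (1 - t) *\<^sub>R mat 1" for t :: real
  have "continuous_on {0..1} (\<lambda>t. det (G t))"
    unfolding G_def det_def by (auto intro!: continuous_intros)
  moreover have "G 0 = mat 1" "G 1 = M"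
    by (auto simp: G_def)
  ultimately obtain t where t: "0 \<le> t" "t \<le> 1" "det (G t) = 0"
    using IVT2'[of "\<lambda>t. det (G t)" 1 0 0] \<open>\<not> det M > 0\<close> by (auto simp: not_less)
  then obtain u where u: "u \<noteq> 0" "G t *v u = 0"
    by (metis invertible_det_nz matrix_left_invertible_ker invertible_left_inverse)
  have "0 = u \<bullet> (G t *v u)"
    using u by simp
  also have "\<dots> = t * (u \<bullet> (M *v u)) + (1 - t) * (u \<bullet> u)"
    by (simp add: G_def matrix_vector_mult_add_rdistrib scaleR_matrix_vector_assoc[symmetric] inner_add_right)
  also have "\<dots> > 0"
    using t assms[OF u(1)] u(1) by (cases "t = 0") (auto intro!: add_pos_nonneg mult_pos_pos)
  finally show False
    by simp
qed

section \<open>Derivatives in the fibre coordinates\<close>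

lemma dy_slice_has_derivative:
  assumes "h differentiable (at (x, y))"
  shows "((\<lambda>y. h (x, y)) has_derivative (\<lambda>v. \<Sum>i\<in>UNIV. v $ i * dy i h (x, y))) (at y)"
proof -
  let ?D = "frechet_derivative h (at (x, y))"
  have D: "(h has_derivative ?D) (at (x, y))"
    using assms by (simp add: frechet_derivative_works)
  then have lin: "linear ?D"
    by (rule has_derivative_linear)
  have "?D (0, v) = (\<Sum>i\<in>UNIV. v $ i * dy i h (x, y))" for v
  proof -
    have eq: "(0, v) = (\<Sum>i\<in>UNIV. v $ i *\<^sub>R (0, axis i 1))"
      by (simp add: sum_prod basis_expansion[of v, unfolded scalar_mult_eq_scaleR])
    show ?thesis
      by (subst eq) (simp only: linear_sum[OF lin] linear_cmul[OF lin] dy_def real_scaleR_def)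
  qed
  moreover have "((\<lambda>y. (x, y)) has_derivative (\<lambda>v. (0, v))) (at y)"
    by (auto intro!: derivative_eq_intros)
  from has_derivative_compose[OF this D] have "((\<lambda>y. h (x, y)) has_derivative (\<lambda>v. ?D (0, v))) (at y)" .
  ultimately show ?thesis
    by simp
qed

lemma differentiable_transform_open:
  assumes "f differentiable (at x)" "open S" "x \<in> S" "\<And>x. x \<in> S \<Longrightarrow> f x = g x"
  shows "g differentiable (at x)"
  using assms unfolding differentiable_def by (blast intro: has_derivative_transform_within_open)

text \<open>
  The chain rule in the fibre coordinates. Sums of functions are admitted on the right-hand side
  because the rule is applied twice to pass to second derivatives, and the first application
  produces such a sum.
\<close>

lemma dy_linear_change:
  fixes L :: "real ^ 'n \<Rightarrow> real ^ 'n" and h :: "(real ^ 'n) \<times> (real ^ 'n) \<Rightarrow> real"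
  assumes L: "linear L" and y: "y \<noteq> 0"
    and eq: "\<And>y. y \<noteq> 0 \<Longrightarrow> h (x, y) = (\<Sum>a\<in>I. c a * k a (x', L y))"
    and h: "h differentiable (at (x, y))"
    and k: "\<And>a. a \<in> I \<Longrightarrow> k a differentiable (at (x', L y))"
  shows "dy i h (x, y) = (\<Sum>a\<in>I. c a * (\<Sum>b\<in>UNIV. L (axis i 1) $ b * dy b (k a) (x', L y)))"
proof -
  let ?D = "\<lambda>v. \<Sum>a\<in>I. c a * (\<Sum>b\<in>UNIV. L v $ b * dy b (k a) (x', L y))"
  have "((\<lambda>y. k a (x', L y)) has_derivative (\<lambda>v. \<Sum>b\<in>UNIV. L v $ b * dy b (k a) (x', L y))) (at y)"
    if "a \<in> I" for a
    using has_derivative_compose[OF linear_imp_has_derivative[OF L] dy_slice_has_derivative[OF k[OF that]]] .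
  then have "((\<lambda>y. \<Sum>a\<in>I. c a * k a (x', L y)) has_derivative ?D) (at y)"
    by (intro has_derivative_sum has_derivative_mult_right)
  then have "((\<lambda>y. h (x, y)) has_derivative ?D) (at y)"
    by (rule has_derivative_transform_within_open[of _ _ _ _ "- {0}"]) (use y eq in auto)
  with dy_slice_has_derivative[OF h] have "(\<lambda>v. \<Sum>i\<in>UNIV. v $ i * dy i h (x, y)) = ?D"
    by (rule has_derivative_unique)
  from fun_cong[OF this, of "axis i 1"] show ?thesis
    by (simp add: axis_def if_distrib[of "\<lambda>x. x * _"] cong: if_cong)
qed

section \<open>Finsler metrics in coordinates\<close>

text \<open>
  The fundamental tensor, the unit ball and the distortion depend on a chart only through the
  coordinate expression \<open>N\<close> of the metric. Stated for \<open>N\<close>, they can be studied on an open subset of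
  Euclidean space.
\<close>

definition metric_tensor :: "((real ^ 'n) \<times> (real ^ 'n) \<Rightarrow> real) \<Rightarrow> (real ^ 'n) \<times> (real ^ 'n) \<Rightarrow> real ^ 'n ^ 'n"
  where "metric_tensor N z = (\<chi> i j. dy j (dy i (\<lambda>z. (N z)\<^sup>2)) z / 2)"

definition unit_ball :: "((real ^ 'n) \<times> (real ^ 'n) \<Rightarrow> real) \<Rightarrow> real ^ 'n \<Rightarrow> (real ^ 'n) set"
  where "unit_ball N x = {y. y = 0 \<or> N (x, y) < 1}"

definition distortion_of :: "((real ^ 'n) \<times> (real ^ 'n) \<Rightarrow> real) \<Rightarrow> (real ^ 'n) \<times> (real ^ 'n) \<Rightarrow> real"
  where "distortion_of N z = ln (sqrt (det (metric_tensor N z)) /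
    (measure lebesgue (ball 0 1 :: (real ^ 'n) set) / measure lebesgue (unit_ball N (fst z))))"

lemma distortion_eq: "distortion A F c = distortion_of (local_F A F c)"
proof -
  have "local_F2 A F c = (\<lambda>z. (local_F A F c z)\<^sup>2)"
    by (simp add: fun_eq_iff local_F2_def)
  then show ?thesis
    by (intro ext) (simp only: split_paired_all distortion_def distortion_of_def fst_conv bh_density_def unit_ball_def
        fundamental_tensor_def metric_tensor_def)
qed

text \<open>
  The coordinate expression of a Finsler metric in a chart with image \<open>U\<close>.
\<close>

locale local_finsler =
  fixes U :: "(real ^ 'n) set" and N :: "(real ^ 'n) \<times> (real ^ 'n) \<Rightarrow> real"
  assumes open_U: "open U"
    and smooth: "smooth_on (U \<times> (UNIV - {0})) N"
    and pos: "x \<in> U \<Longrightarrow> y \<noteq> 0 \<Longrightarrow> N (x, y) > 0"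
    and hom: "x \<in> U \<Longrightarrow> y \<noteq> 0 \<Longrightarrow> r > 0 \<Longrightarrow> N (x, r *\<^sub>R y) = r * N (x, y)"
    and posdef: "x \<in> U \<Longrightarrow> y \<noteq> 0 \<Longrightarrow> u \<noteq> 0 \<Longrightarrow> u \<bullet> (metric_tensor N (x, y) *v u) > 0"
begin

abbreviation slit :: "((real ^ 'n) \<times> (real ^ 'n)) set" where
  "slit \<equiv> U \<times> (UNIV - {0})"

lemma open_slit: "open slit"
  using open_U by (intro open_Times) auto

lemma smooth_derivatives:
  shows N_differentiable: "z \<in> slit \<Longrightarrow> N differentiable (at z)"
    and continuous_N': "continuous_on slit (\<lambda>z. frechet_derivative N (at z) v)"
    and dy_N_differentiable: "z \<in> slit \<Longrightarrow> dy i N differentiable (at z)"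
    and dy_dy_N_differentiable: "z \<in> slit \<Longrightarrow> dy j (dy i N) differentiable (at z)"
proof -
  have 1: "Ck_on (Suc 0) slit N" and 3: "Ck_on (Suc (Suc (Suc 0))) slit N"
    using smooth by (auto simp: smooth_on_def simp del: Ck_on.simps)
  show "z \<in> slit \<Longrightarrow> N differentiable (at z)"
    and "continuous_on slit (\<lambda>z. frechet_derivative N (at z) v)"
    using 1 unfolding Ck_on.simps by blast+
  show "z \<in> slit \<Longrightarrow> dy i N differentiable (at z)"
    and "z \<in> slit \<Longrightarrow> dy j (dy i N) differentiable (at z)"
    using 3 unfolding dy_def[abs_def] Ck_on.simps by blast+
qed

lemma continuous_N: "continuous_on slit N"
  using N_differentiable by (meson continuous_at_imp_continuous_on differentiable_imp_continuous_within)

lemma N2_differentiable: "z \<in> slit \<Longrightarrow> (\<lambda>z. (N z)\<^sup>2) differentiable (at z)"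
  using N_differentiable by (simp add: power2_eq_square differentiable_mult)

lemma dy_N2:
  assumes "z \<in> slit"
  shows "dy i (\<lambda>z. (N z)\<^sup>2) z = 2 * (N z * dy i N z)"
proof -
  have "(N has_derivative frechet_derivative N (at z)) (at z)"
    using N_differentiable[OF assms] by (simp add: frechet_derivative_works)
  then have "((\<lambda>z. (N z)\<^sup>2) has_derivative (\<lambda>v. 2 * (N z * frechet_derivative N (at z) v))) (at z)"
    by (auto intro!: derivative_eq_intros)
  then show ?thesis
    by (simp add: dy_def frechet_derivative_at[symmetric])
qed

lemma dy_N2_differentiable:
  assumes "z \<in> slit"
  shows "dy i (\<lambda>z. (N z)\<^sup>2) differentiable (at z)"
proof (rule differentiable_transform_open[OF _ open_slit assms])
  show "(\<lambda>z. 2 * (N z * dy i N z)) differentiable (at z)"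
    using N_differentiable[OF assms] dy_N_differentiable[OF assms] by (intro derivative_intros)
qed (simp add: dy_N2)

lemma dy_dy_N2_differentiable:
  assumes "z \<in> slit"
  shows "dy j (dy i (\<lambda>z. (N z)\<^sup>2)) differentiable (at z)"
proof (rule differentiable_transform_open[OF _ open_slit assms])
  show "(\<lambda>z. 2 * (dy j N z * dy i N z + N z * dy j (dy i N) z)) differentiable (at z)"
    using N_differentiable[OF assms] dy_N_differentiable[OF assms] dy_dy_N_differentiable[OF assms]
    by (intro derivative_intros)
  fix z assume z: "z \<in> slit"
  have "(N has_derivative frechet_derivative N (at z)) (at z)"
    "(dy i N has_derivative frechet_derivative (dy i N) (at z)) (at z)"
    using N_differentiable[OF z] dy_N_differentiable[OF z] by (simp_all add: frechet_derivative_works)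
  then have "((\<lambda>z. 2 * (N z * dy i N z)) has_derivative (\<lambda>v. 2 * (frechet_derivative N (at z) v * dy i N z +
      N z * frechet_derivative (dy i N) (at z) v))) (at z)"
    by (auto intro!: derivative_eq_intros)
  then have "(dy i (\<lambda>z. (N z)\<^sup>2) has_derivative (\<lambda>v. 2 * (frechet_derivative N (at z) v * dy i N z +
      N z * frechet_derivative (dy i N) (at z) v))) (at z)"
    by (rule has_derivative_transform_within_open[OF _ open_slit z]) (simp add: dy_N2)
  then show "2 * (dy j N z * dy i N z + N z * dy j (dy i N) z) = dy j (dy i (\<lambda>z. (N z)\<^sup>2)) z"
    by (simp add: dy_def[of j] frechet_derivative_at[symmetric])
qed

lemma det_metric_tensor_differentiable:
  assumes "z \<in> slit"
  shows "(\<lambda>z. det (metric_tensor N z)) differentiable (at z)"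
proof -
  have "\<exists>D. ((\<lambda>z. metric_tensor N z $ i $ j) has_derivative D) (at z)" for i j
  proof -
    have "(\<lambda>z. dy j (dy i (\<lambda>z. (N z)\<^sup>2)) z / 2) differentiable (at z)"
      using dy_dy_N2_differentiable[OF assms] by (intro derivative_intros) auto
    then show ?thesis
      by (simp add: metric_tensor_def differentiable_def)
  qed
  then obtain D where D: "\<And>i j. ((\<lambda>z. metric_tensor N z $ i $ j) has_derivative D i j) (at z)"
    by metis
  show ?thesis
    unfolding det_def differentiable_def
    by (rule exI[of _ "\<lambda>v. \<Sum>p | p permutes UNIV. of_int (sign p) *
        (\<Sum>i\<in>UNIV. D i (p i) v * (\<Prod>j\<in>UNIV - {i}. metric_tensor N z $ j $ p j))"])
      (intro has_derivative_sum has_derivative_mult_right has_derivative_prod D)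
qed

lemma det_metric_tensor_pos: "x \<in> U \<Longrightarrow> y \<noteq> 0 \<Longrightarrow> det (metric_tensor N (x, y)) > 0"
  by (intro det_pos_if_positive_definite posdef)

text \<open>
  \<open>N\<^sup>2\<close> is homogeneous of degree 2 in \<open>y\<close>, and each derivative in \<open>y\<close> lowers the degree by one.
\<close>

lemma metric_tensor_scale:
  assumes x: "x \<in> U" and y: "y \<noteq> 0" and r: "r > 0"
  shows "metric_tensor N (x, r *\<^sub>R y) = metric_tensor N (x, y)"
proof -
  let ?h = "\<lambda>z. (N z)\<^sup>2"
  have lin: "linear ((*\<^sub>R) r :: real ^ 'n \<Rightarrow> _)"
    by (simp add: linear_scale_self)
  have dy1: "dy i ?h (x, y) = (1 / r) * dy i ?h (x, r *\<^sub>R y)" if y: "y \<noteq> 0" for i y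
  proof -
    have "?h (x, y) = (\<Sum>a\<in>{()}. (1 / r\<^sup>2) * ?h (x, r *\<^sub>R y))" if "y \<noteq> 0" for y
      using hom[OF x that r] r by (simp add: power_mult_distrib)
    from dy_linear_change[OF lin y this N2_differentiable N2_differentiable]
    show ?thesis
      using x y r by (simp add: axis_def if_distrib[of "\<lambda>x. x * _"] if_distrib[of "\<lambda>x. r * x"] power2_eq_square cong: if_cong)
  qed
  have "dy j (dy i ?h) (x, y) = dy j (dy i ?h) (x, r *\<^sub>R y)" for i j
  proof -
    have "dy i ?h (x, y) = (\<Sum>a\<in>{()}. (1 / r) * dy i ?h (x, r *\<^sub>R y))" if "y \<noteq> 0" for y
      using dy1[OF that] by simp
    from dy_linear_change[OF lin y this dy_N2_differentiable dy_N2_differentiable]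
    show ?thesis
      using x y r by (simp add: axis_def if_distrib[of "\<lambda>x. x * _"] if_distrib[of "\<lambda>x. r * x"] cong: if_cong)
  qed
  then show ?thesis
    by (simp add: metric_tensor_def)
qed

text \<open>
  The map \<open>L\<close> from the fibre at \<open>x\<close> to the fibre at \<open>x'\<close> is fixed, so that no derivatives in \<open>x\<close> occur and
  the Hessian transforms like a quadratic form.
\<close>

lemma metric_tensor_linear_change:
  assumes x: "x \<in> U" and x': "x' \<in> U" and L: "linear L" and nz: "\<And>y. y \<noteq> 0 \<Longrightarrow> L y \<noteq> 0"
    and eq: "\<And>y. y \<noteq> 0 \<Longrightarrow> N (x, y) = N (x', L y)" and y: "y \<noteq> 0"
  shows "metric_tensor N (x, y) = transpose (matrix L) ** metric_tensor N (x', L y) ** matrix L"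
proof -
  let ?h = "\<lambda>z. (N z)\<^sup>2"
  have dy1: "dy i ?h (x, y) = (\<Sum>a\<in>UNIV. L (axis i 1) $ a * dy a ?h (x', L y))" if y: "y \<noteq> 0" for i y
  proof -
    have "?h (x, y) = (\<Sum>a\<in>{()}. 1 * ?h (x', L y))" if "y \<noteq> 0" for y
      using eq[OF that] by simp
    from dy_linear_change[OF L y this N2_differentiable N2_differentiable]
    show ?thesis
      using x x' y nz by simp
  qed
  have dy2: "dy j (dy i ?h) (x, y) =
      (\<Sum>a\<in>UNIV. L (axis i 1) $ a * (\<Sum>b\<in>UNIV. L (axis j 1) $ b * dy b (dy a ?h) (x', L y)))" for i j
    by (rule dy_linear_change[OF L y dy1 dy_N2_differentiable dy_N2_differentiable])
      (use x x' y nz in auto)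
  show ?thesis
    unfolding vec_eq_iff metric_tensor_def matrix_matrix_mult_def transpose_def matrix_def
    by (simp add: dy2 sum_distrib_left sum_distrib_right sum_divide_distrib mult_ac, subst sum.swap, simp)
qed

end

section \<open>Functions with proportional distributions\<close>

text \<open>
  The half-lines \<open>{..<r}\<close> generate the Borel sets, so the volumes of the sublevel sets of a function
  determine the image of Lebesgue measure. Here the two image measures are \<open>a\<close> and \<open>b\<close> times the same
  measure.
\<close>

lemma nn_integral_comp_proportional:
  fixes f g :: "'a::euclidean_space \<Rightarrow> real" and \<phi> :: "real \<Rightarrow> ennreal"
  assumes meas: "f \<in> borel_measurable lborel" "g \<in> borel_measurable lborel" "\<phi> \<in> borel_measurable borel"
    and f: "\<And>r. emeasure lborel {y. f y < r} = ennreal (a * max 0 r ^ n)"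
    and g: "\<And>r. emeasure lborel {y. g y < r} = ennreal (b * max 0 r ^ n)"
    and nonneg: "a \<ge> 0" "b \<ge> 0"
  shows "ennreal b * (\<integral>\<^sup>+y. \<phi> (f y) \<partial>lborel) = ennreal a * (\<integral>\<^sup>+y. \<phi> (g y) \<partial>lborel)"
proof -
  let ?M = "scale_measure (ennreal b) (distr lborel borel f)"
  let ?N = "scale_measure (ennreal a) (distr lborel borel g)"
  have M: "emeasure ?M {..<r} = ennreal (b * (a * max 0 r ^ n))" for r
    using f[of r] meas nonneg by (simp add: emeasure_distr vimage_def ennreal_mult)
  have N: "emeasure ?N {..<r} = ennreal (a * (b * max 0 r ^ n))" for r
    using g[of r] meas nonneg by (simp add: emeasure_distr vimage_def ennreal_mult)
  have "?M = ?N"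
  proof (rule measure_eqI_generator_eq)
    have "{..<r} \<inter> {..<s} = {..<min r s}" for r s :: real
      by auto
    then show "Int_stable (range (\<lambda>r::real. {..<r}))"
      by (auto simp: Int_stable_def)
    show "sets ?M = sigma_sets UNIV (range lessThan)" "sets ?N = sigma_sets UNIV (range lessThan)"
      by (simp_all add: sets_scale_measure borel_Iio)
    show "emeasure ?M X = emeasure ?N X" if "X \<in> range lessThan" for X
      using that M N by (auto simp: mult_ac)
    show "(\<Union>i. {..<real i}) = UNIV"
      using reals_Archimedean2 by blast
    show "emeasure ?M {..<real i} \<noteq> \<infinity>" for i
      unfolding M by simp
  qed auto
  then have "integral\<^sup>N ?M \<phi> = integral\<^sup>N ?N \<phi>"
    by simp
  then show ?thesis
    using meas by (simp add: nn_integral_scale_measure nn_integral_distr)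
qed

text \<open>
  A continuously differentiable function that is positive on the open interval from 1 to 2 and zero
  elsewhere. Its support avoids 0, where \<open>N\<close> is not differentiable, and is bounded.
\<close>

definition bump :: "real \<Rightarrow> real" where
  "bump r = (max 0 ((r - 1) * (2 - r)))\<^sup>2"

definition bump' :: "real \<Rightarrow> real" where
  "bump' r = 2 * max 0 ((r - 1) * (2 - r)) * (3 - 2 * r)"

lemma bump_eq_0: "r \<le> 1 \<or> r \<ge> 2 \<Longrightarrow> bump r = 0"
  and bump'_eq_0: "r \<le> 1 \<or> r \<ge> 2 \<Longrightarrow> bump' r = 0"
proof -
  assume "r \<le> 1 \<or> r \<ge> 2"
  then have "(r - 1) * (2 - r) \<le> 0"
    by (auto simp: mult_le_0_iff)
  then show "bump r = 0" "bump' r = 0"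
    by (simp_all add: bump_def bump'_def max_def)
qed

lemma bump_bounds: "0 \<le> bump r" "bump r \<le> 1"
proof -
  have "1 - (r - 1) * (2 - r) = (r - 3 / 2)\<^sup>2 + 3 / 4"
    by (simp add: power2_eq_square algebra_simps)
  then have "(r - 1) * (2 - r) \<le> 1"
    using zero_le_power2[of "r - 3 / 2"] by linarith
  then show "0 \<le> bump r" "bump r \<le> 1"
    by (auto simp: bump_def intro!: power_le_one)
qed

lemma continuous_bump: "continuous_on S bump"
  and continuous_bump': "continuous_on S bump'"
  unfolding bump_def bump'_def by (auto intro!: continuous_intros)

lemma DERIV_bump: "(bump has_real_derivative bump' r) (at r)"
proof -
  have sq: "((\<lambda>t. (max 0 t)\<^sup>2) has_real_derivative 2 * max 0 t) (at t)" for t :: real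
  proof (cases t "0::real" rule: linorder_cases)
    case less
    have "((\<lambda>t. 0) has_real_derivative 0) (at t)"
      by simp
    then have "((\<lambda>t. (max 0 t)\<^sup>2) has_real_derivative 0) (at t)"
      by (rule has_field_derivative_transform_within_open[of _ _ _ "{..<0}"]) (use less in auto)
    then show ?thesis
      using less by simp
  next
    case equal
    (* The difference quotient of the squared positive part at 0 is the positive part itself. *)
    have "((\<lambda>h. max 0 h) \<longlongrightarrow> 0) (at (0::real))"
      using tendsto_max[OF tendsto_const tendsto_ident_at, of 0 "0::real"] by simp
    then have "((\<lambda>h. (max 0 h)\<^sup>2 / h) \<longlongrightarrow> 0) (at (0::real))"
      by (rule Lim_transform_eventually)
        (simp add: eventually_at_filter max_def power2_eq_square)
    then show ?thesis
      using equal by (simp add: has_field_derivative_iff)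
  next
    case greater
    have "((\<lambda>t. t\<^sup>2) has_real_derivative 2 * t) (at t)"
      by (auto intro!: derivative_eq_intros)
    then have "((\<lambda>t. (max 0 t)\<^sup>2) has_real_derivative 2 * t) (at t)"
      by (rule has_field_derivative_transform_within_open[of _ _ _ "{0<..}"]) (use greater in auto)
    then show ?thesis
      using greater by simp
  qed
  have "((\<lambda>r. (r - 1) * (2 - r)) has_real_derivative 3 - 2 * r) (at r)"
    by (auto intro!: derivative_eq_intros)
  from DERIV_chain2[OF sq this] show ?thesis
    by (simp add: bump_def[abs_def] bump'_def)
qed

lemma integral_bump_comp_proportional:
  fixes f g :: "'a::euclidean_space \<Rightarrow> real"
  assumes meas: "f \<in> borel_measurable borel" "g \<in> borel_measurable borel"
    and f: "\<And>r. emeasure lborel {y. f y < r} = ennreal (a * max 0 r ^ n)"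
    and g: "\<And>r. emeasure lborel {y. g y < r} = ennreal (b * max 0 r ^ n)"
    and nonneg: "a \<ge> 0" "b \<ge> 0"
  shows "b * integral UNIV (\<lambda>y. bump (f y)) = a * integral UNIV (\<lambda>y. bump (g y))"
proof -
  have bm: "bump \<in> borel_measurable borel"
    using continuous_bump by (rule borel_measurable_continuous_onI)
  have *: "(\<integral>\<^sup>+y. ennreal (bump (f y)) \<partial>lborel) = ennreal (integral UNIV (\<lambda>y. bump (f y))) \<and>
      integral UNIV (\<lambda>y. bump (f y)) \<ge> 0"
    if "f \<in> borel_measurable borel" "emeasure lborel {y. f y < 2} < \<infinity>" for f :: "'a \<Rightarrow> real"
  proof
    have "(\<integral>\<^sup>+y. ennreal (bump (f y)) \<partial>lborel) \<le> (\<integral>\<^sup>+y. indicator {y. f y < 2} y \<partial>lborel)"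
      by (intro nn_integral_mono) (auto simp: indicator_def bump_bounds bump_eq_0)
    also have "\<dots> = emeasure lborel {y. f y < 2}"
      using that(1) by (intro nn_integral_indicator) (simp add: borel_measurable_iff_less)
    finally show "(\<integral>\<^sup>+y. ennreal (bump (f y)) \<partial>lborel) = ennreal (integral UNIV (\<lambda>y. bump (f y)))"
      using that bm by (intro nn_integral_lborel_eq_integral) (auto simp: bump_bounds intro: le_less_trans)
    show "integral UNIV (\<lambda>y. bump (f y)) \<ge> 0"
      by (cases "(\<lambda>y. bump (f y)) integrable_on UNIV")
        (auto intro: integral_nonneg simp: bump_bounds not_integrable_integral)
  qed
  have "ennreal b * (\<integral>\<^sup>+y. ennreal (bump (f y)) \<partial>lborel) = ennreal a * (\<integral>\<^sup>+y. ennreal (bump (g y)) \<partial>lborel)"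
    using meas bm by (intro nn_integral_comp_proportional[OF _ _ _ f g nonneg, of "\<lambda>r. ennreal (bump r)"]) auto
  moreover note *[OF meas(1)] *[OF meas(2)]
  ultimately show ?thesis
    using nonneg by (simp add: f g ennreal_mult[symmetric])
qed

section \<open>The volume of the unit balls\<close>

context local_finsler
begin

text \<open>
  The values of \<open>N\<close> at zero vectors are arbitrary. With the value 0 there, the unit ball is a sublevel
  set and homogeneity holds without exceptions.
\<close>

definition N0 :: "real ^ 'n \<Rightarrow> real ^ 'n \<Rightarrow> real" where
  "N0 x y = (if y = 0 then 0 else N (x, y))"

lemma unit_ball_N0: "unit_ball N x = {y. N0 x y < 1}"
  by (auto simp: unit_ball_def N0_def)

lemma N0_nonneg: "x \<in> U \<Longrightarrow> N0 x y \<ge> 0"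
  using pos[of x y] by (auto simp: N0_def)

text \<open>
  By compactness of a closed ball times the unit sphere, and homogeneity.
\<close>

lemma norm_bounds:
  assumes "x0 \<in> U"
  obtains e m M where "e > 0" "m > 0" "M > 0" "cball x0 e \<subseteq> U"
    "\<And>x y. x \<in> cball x0 e \<Longrightarrow> m * norm y \<le> N0 x y \<and> N0 x y \<le> M * norm y"
proof -
  obtain e where e: "e > 0" "cball x0 e \<subseteq> U"
    using assms open_U open_contains_cball by blast
  let ?K = "cball x0 e \<times> sphere (0 :: real ^ 'n) 1"
  have "axis undefined 1 \<in> sphere (0 :: real ^ 'n) 1"
    by simp
  then have ne: "?K \<noteq> {}"
    using e by fastforce
  have K: "compact ?K" "?K \<subseteq> slit"
    using e by (auto intro: compact_Times)
  then have cont: "continuous_on ?K N"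
    using continuous_N continuous_on_subset by blast
  obtain z1 where z1: "z1 \<in> ?K" "\<And>z. z \<in> ?K \<Longrightarrow> N z1 \<le> N z"
    using continuous_attains_inf[OF K(1) ne cont] by blast
  obtain z2 where z2: "z2 \<in> ?K" "\<And>z. z \<in> ?K \<Longrightarrow> N z \<le> N z2"
    using continuous_attains_sup[OF K(1) ne cont] by blast
  have posK: "N z > 0" if "z \<in> ?K" for z
    using subsetD[OF K(2) that] pos[of "fst z" "snd z"] by (auto simp: mem_Times_iff)
  have "N z1 * norm y \<le> N0 x y \<and> N0 x y \<le> N z2 * norm y" if x: "x \<in> cball x0 e" for x y
  proof (cases "y = 0")
    case False
    have "N (x, y) = N (x, norm y *\<^sub>R (y /\<^sub>R norm y))"
      using False by simp
    also have "\<dots> = norm y * N (x, y /\<^sub>R norm y)"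
      using False x e by (intro hom) auto
    finally have eq: "N0 x y = norm y * N (x, y /\<^sub>R norm y)"
      using False by (simp add: N0_def)
    have "(x, y /\<^sub>R norm y) \<in> ?K"
      using False x by auto
    from z1(2)[OF this] z2(2)[OF this] show ?thesis
      unfolding eq by (simp add: mult.commute[of _ "norm y"] mult_left_mono)
  qed (simp add: N0_def)
  with that[OF e(1) posK[OF z1(1)] posK[OF z2(1)] e(2)] show ?thesis
    by blast
qed

lemma open_sublevel:
  assumes x: "x \<in> U"
  shows "open {y. N0 x y < r}"
proof (cases "r > 0")
  case True
  obtain e m M where b: "e > 0" "m > 0" "M > 0"
    "\<And>x' y. x' \<in> cball x e \<Longrightarrow> m * norm y \<le> N0 x' y \<and> N0 x' y \<le> M * norm y"
    using norm_bounds[OF x] by metis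
  have "continuous_on (- {0}) (\<lambda>y. N (x, y))"
    by (rule continuous_on_compose2[OF continuous_N]) (use x in \<open>auto intro!: continuous_intros\<close>)
  then have "open ((- {0}) \<inter> (\<lambda>y. N (x, y)) -` {..<r})"
    by (intro continuous_open_preimage) auto
  moreover have "{y. N0 x y < r} = ball 0 (r / M) \<union> ((- {0}) \<inter> (\<lambda>y. N (x, y)) -` {..<r})"
  proof -
    have "N0 x y < r" if "norm y < r / M" for y
      using b(4)[of x y] b(1,3) that by (auto simp: field_simps intro: le_less_trans)
    then have "ball 0 (r / M) \<subseteq> {y. N0 x y < r}"
      by auto
    then show ?thesis
      using True b(3) by (auto simp: N0_def)
  qed
  ultimately show ?thesis
    by auto
next
  case False
  then have "{y. N0 x y < r} = {}"
    using N0_nonneg[OF x] by (smt (verit) Collect_empty_eq)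
  then show ?thesis
    by simp
qed

lemma bounded_sublevel:
  assumes x: "x \<in> U"
  shows "bounded {y. N0 x y < r}"
proof -
  obtain e m M where b: "e > 0" "m > 0"
    "\<And>x' y. x' \<in> cball x e \<Longrightarrow> m * norm y \<le> N0 x' y \<and> N0 x' y \<le> M * norm y"
    using norm_bounds[OF x] by metis
  have "norm y \<le> r / m" if "N0 x y < r" for y
    using b(3)[of x y] b(1,2) that by (auto simp: field_simps)
  then show ?thesis
    by (intro boundedI[of _ "r / m"]) auto
qed

lemma unit_ball_lmeasurable: "x \<in> U \<Longrightarrow> unit_ball N x \<in> lmeasurable"
  unfolding unit_ball_N0 by (intro lmeasurable_open bounded_sublevel open_sublevel)

lemma measure_unit_ball_pos:
  assumes "x \<in> U"
  shows "measure lebesgue (unit_ball N x) > 0"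
proof -
  have "0 \<in> unit_ball N x" and "open (unit_ball N x)"
    using open_sublevel[OF assms] by (auto simp: unit_ball_N0 N0_def)
  then obtain d where d: "d > 0" "ball 0 d \<subseteq> unit_ball N x"
    by (meson open_contains_ball)
  have "0 < measure lebesgue (ball (0 :: real ^ 'n) d)"
    using d(1) content_ball_pos[of d 0] by simp
  also have "\<dots> \<le> measure lebesgue (unit_ball N x)"
    by (intro measure_mono_fmeasurable d(2) unit_ball_lmeasurable assms) auto
  finally show ?thesis .
qed

lemma emeasure_sublevel:
  assumes x: "x \<in> U"
  shows "emeasure lborel {y. N0 x y < r} =
    ennreal (measure lebesgue (unit_ball N x) * max 0 r ^ CARD('n))"
proof (cases "r > 0")
  case True
  have sc: "N0 x (r *\<^sub>R y) = r * N0 x y" if "r > 0" for r y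
    using hom[OF x _ that] that by (auto simp: N0_def)
  have "y \<in> (\<lambda>y. r *\<^sub>R y + 0) ` unit_ball N x" if "N0 x y < r" for y
  proof (rule image_eqI[of _ _ "y /\<^sub>R r"])
    show "y /\<^sub>R r \<in> unit_ball N x"
      using that sc[of "inverse r" y] True by (simp add: unit_ball_N0 divide_inverse_commute[symmetric])
  qed (use True in simp)
  then have "{y. N0 x y < r} = (\<lambda>y. r *\<^sub>R y + 0) ` unit_ball N x"
    using True by (auto simp: unit_ball_N0 sc)
  then have "measure lebesgue {y. N0 x y < r} = r ^ CARD('n) * measure lebesgue (unit_ball N x)"
    using measure_lebesgue_affine[of r 0 "unit_ball N x"] True by simp
  moreover have "{y. N0 x y < r} \<in> lmeasurable"
    by (intro lmeasurable_open bounded_sublevel open_sublevel x)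
  then have "emeasure lebesgue {y. N0 x y < r} = ennreal (measure lebesgue {y. N0 x y < r})"
    by (simp add: emeasure_eq_measure2)
  ultimately show ?thesis
    using True open_sublevel[OF x, of r] by (simp add: mult.commute)
next
  case False
  then have "{y. N0 x y < r} = {}"
    using N0_nonneg[OF x] by (smt (verit) Collect_empty_eq)
  then show ?thesis
    using False by simp
qed

lemma N0_borel_measurable: "x \<in> U \<Longrightarrow> N0 x \<in> borel_measurable borel"
  using open_sublevel by (intro borel_measurableI_less) auto

text \<open>
  With \<open>x'\<close> fixed this expresses the volume of the unit ball at \<open>x\<close> by an integral whose integrand, rather
  than its domain, depends on \<open>x\<close>.
\<close>

lemma volume_proportional:
  assumes "x \<in> U" "x' \<in> U"
  shows "measure lebesgue (unit_ball N x) * integral UNIV (\<lambda>y. bump (N0 x' y)) =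
    measure lebesgue (unit_ball N x') * integral UNIV (\<lambda>y. bump (N0 x y))"
  using integral_bump_comp_proportional[OF N0_borel_measurable N0_borel_measurable emeasure_sublevel emeasure_sublevel]
    assms by simp

text \<open>
  The derivative of \<open>bump (N0 x y)\<close> in \<open>x\<close>, as a bounded linear map, which is the form in which
  continuity is required for differentiating under the integral sign.
\<close>

definition bump_N0_derivative :: "real ^ 'n \<Rightarrow> real ^ 'n \<Rightarrow> (real ^ 'n) \<Rightarrow>\<^sub>L real" where
  "bump_N0_derivative x y = (if y = 0 then 0
     else Blinfun (\<lambda>v. bump' (N (x, y)) * frechet_derivative N (at (x, y)) (v, 0)))"

lemma bump_N0_derivative_apply:
  assumes "x \<in> U" 
  shows "blinfun_apply (bump_N0_derivative x y) =
    (if y = 0 then (\<lambda>v. 0) else (\<lambda>v. bump' (N (x, y)) * frechet_derivative N (at (x, y)) (v, 0)))"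
proof (cases "y = 0")
  case False
  have "linear (frechet_derivative N (at (x, y)))"
    using assms False by (intro linear_frechet_derivative N_differentiable) auto
  moreover have "linear (\<lambda>v :: real ^ 'n. (v, 0 :: real ^ 'n))"
    by (auto intro: linearI)
  ultimately have "linear (\<lambda>v. frechet_derivative N (at (x, y)) (v, 0))"
    using linear_compose[of "\<lambda>v. (v, 0)" "frechet_derivative N (at (x, y))"] by (simp add: o_def)
  then have "bounded_linear (\<lambda>v. bump' (N (x, y)) * frechet_derivative N (at (x, y)) (v, 0))"
    by (intro bounded_linear_const_mult) (simp add: linear_conv_bounded_linear)
  then show ?thesis
    using False by (simp add: bump_N0_derivative_def bounded_linear_Blinfun_apply)
qed (auto simp: bump_N0_derivative_def)

lemma bump_N0_has_derivative:
  assumes "x \<in> U"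
  shows "((\<lambda>x. bump (N0 x y)) has_derivative blinfun_apply (bump_N0_derivative x y)) (at x)"
proof (cases "y = 0")
  case False
  have D: "(N has_derivative frechet_derivative N (at (x, y))) (at (x, y))"
    using N_differentiable[of "(x, y)"] assms False by (simp add: frechet_derivative_works)
  have "((\<lambda>x. (x, y)) has_derivative (\<lambda>v. (v, 0))) (at x)"
    by (auto intro!: derivative_eq_intros)
  from has_derivative_compose[OF this D]
  have "((\<lambda>x. N (x, y)) has_derivative (\<lambda>v. frechet_derivative N (at (x, y)) (v, 0))) (at x)" .
  from has_derivative_compose[OF this DERIV_bump[unfolded has_field_derivative_def]]
  show ?thesis
    using False assms by (simp add: bump_N0_derivative_apply N0_def)
qed (simp add: N0_def bump_N0_derivative_def zero_blinfun.rep_eq)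

lemma continuous_bump_N0:
  assumes "x \<in> U"
  shows "continuous_on UNIV (\<lambda>y. bump (N0 x y))"
proof -
  obtain e m M where b: "e > 0" "M > 0"
    "\<And>x' y. x' \<in> cball x e \<Longrightarrow> m * norm y \<le> N0 x' y \<and> N0 x' y \<le> M * norm y"
    using norm_bounds[OF assms] by metis
  have "bump (N0 x y) = 0" if "norm y < 1 / M" for y
    using b(3)[of x y] b(1,2) that by (intro bump_eq_0) (auto simp: field_simps)
  then have "continuous_on (ball 0 (1 / M)) (\<lambda>y. bump (N0 x y))"
    by (subst continuous_on_cong[OF refl, where g = "\<lambda>_. 0"]) auto
  moreover have "continuous_on (- {0}) (\<lambda>y. bump (N (x, y)))"
    by (intro continuous_on_compose2[OF continuous_bump[of UNIV]] continuous_on_compose2[OF continuous_N])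
      (use assms in \<open>auto intro!: continuous_intros\<close>)
  then have "continuous_on (- {0}) (\<lambda>y. bump (N0 x y))"
    by (subst continuous_on_cong[OF refl, where g = "\<lambda>y. bump (N (x, y))"]) (auto simp: N0_def)
  ultimately have "continuous_on (ball 0 (1 / M) \<union> - {0}) (\<lambda>y. bump (N0 x y))"
    by (intro continuous_on_open_Un) auto
  moreover have "ball 0 (1 / M) \<union> - {0} = (UNIV :: (real ^ 'n) set)"
    using b by auto
  ultimately show ?thesis
    by simp
qed

lemma integral_bump_restrict:
  assumes "{y. N0 x y < 2} \<subseteq> S"
  shows "integral UNIV (\<lambda>y. bump (N0 x y)) = integral S (\<lambda>y. bump (N0 x y))"
proof -
  have "integral S (\<lambda>y. bump (N0 x y)) = integral UNIV (\<lambda>y. if y \<in> S then bump (N0 x y) else 0)"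
    by (simp add: integral_restrict_UNIV)
  also have "(\<lambda>y. if y \<in> S then bump (N0 x y) else 0) = (\<lambda>y. bump (N0 x y))"
  proof
    show "(if y \<in> S then bump (N0 x y) else 0) = bump (N0 x y)" for y
      by (cases "N0 x y < 2") (use assms bump_eq_0[of "N0 x y"] in auto)
  qed
  finally show ?thesis ..
qed

text \<open>
  Differentiation under the integral sign. For \<open>x\<close> near \<open>x0\<close>, the bounds on \<open>N\<close> confine the support of
  the integrand to an annulus \<open>1 / M \<le> norm y \<le> 2 / m\<close>: it lies in a fixed box and keeps away from
  the zero vector, so the derivative is continuous there as well.
\<close>

lemma integral_bump_differentiable:
  assumes x0: "x0 \<in> U"
  shows "(\<lambda>x. integral UNIV (\<lambda>y. bump (N0 x y))) differentiable (at x0)"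
proof -
  obtain e m M where e: "e > 0" "m > 0" "M > 0" "cball x0 e \<subseteq> U"
    and b: "\<And>x y. x \<in> cball x0 e \<Longrightarrow> m * norm y \<le> N0 x y \<and> N0 x y \<le> M * norm y"
    using norm_bounds[OF x0] by metis
  let ?B = "ball x0 e"
  have B: "?B \<subseteq> U"
    using e by auto
  obtain a where a: "cball 0 (2 / m) \<subseteq> cbox (- a) (a :: real ^ 'n)"
    using bounded_subset_cbox_symmetric[OF bounded_cball] by metis
  have supp: "{y. N0 x y < 2} \<subseteq> cbox (- a) a" if "x \<in> ?B" for x
  proof -
    have "norm y \<le> 2 / m" if "N0 x y < 2" for y
      using b[of x y] \<open>x \<in> ?B\<close> that e by (auto simp: field_simps)
    then show ?thesis
      using a by auto
  qed
  have cont: "continuous_on (?B \<times> UNIV) (\<lambda>(x, y). bump_N0_derivative x y)"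
  proof (rule continuous_on_blinfun_componentwise)
    fix v :: "real ^ 'n"
    (* Two open sets cover the domain: where y is nonzero, and where y is so small that N0 x y < 1. *)
    let ?g = "\<lambda>z. blinfun_apply (case z of (x, y) \<Rightarrow> bump_N0_derivative x y) v"
    have "continuous_on (?B \<times> - {0}) (\<lambda>z. bump' (N z) * frechet_derivative N (at z) (v, 0))"
      by (intro continuous_on_mult continuous_on_compose2[OF continuous_bump'[of UNIV]]
          continuous_on_subset[OF continuous_N] continuous_on_subset[OF continuous_N']) (use B in auto)
    then have 1: "continuous_on (?B \<times> - {0}) ?g"
      by (rule continuous_on_eq) (use B in \<open>auto simp: bump_N0_derivative_apply subset_iff split: if_split_asm\<close>)
    have "?g z = 0" if "z \<in> ?B \<times> ball 0 (1 / M)" for z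
    proof -
      obtain x y where z: "z = (x, y)" "x \<in> ?B" "norm y < 1 / M"
        using \<open>z \<in> ?B \<times> ball 0 (1 / M)\<close> by auto
      have "N0 x y \<le> 1"
        using b[of x y] z e by (auto simp: field_simps)
      then show ?thesis
        using z B by (auto simp: bump_N0_derivative_apply bump'_eq_0 N0_def subset_iff)
    qed
    then have 2: "continuous_on (?B \<times> ball 0 (1 / M)) ?g"
      by (subst continuous_on_cong[OF refl, where g = "\<lambda>_. 0"]) auto
    have "continuous_on (?B \<times> - {0} \<union> ?B \<times> ball 0 (1 / M)) ?g"
      by (intro continuous_on_open_Un 1 2 open_Times) auto
    moreover have "?B \<times> - {0} \<union> ?B \<times> ball 0 (1 / M) = ?B \<times> (UNIV :: (real ^ 'n) set)"
      using e by auto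
    ultimately show "continuous_on (?B \<times> UNIV) ?g"
      by simp
  qed
  have der: "((\<lambda>x. bump (N0 x y)) has_derivative blinfun_apply (bump_N0_derivative x y)) (at x within ?B)"
    if "x \<in> ?B" for x y
    by (rule has_derivative_at_withinI[OF bump_N0_has_derivative]) (use that B in auto)
  have int: "(\<lambda>y. bump (N0 x y)) integrable_on cbox (- a) a" if "x \<in> ?B" for x
  proof (rule integrable_continuous)
    show "continuous_on (cbox (- a) a) (\<lambda>y. bump (N0 x y))"
      by (rule continuous_on_subset[OF continuous_bump_N0]) (use that B in auto)
  qed
  have cont': "continuous_on (?B \<times> cbox (- a) a) (\<lambda>(x, y). bump_N0_derivative x y)"
    by (rule continuous_on_subset[OF cont]) auto
  have "x0 \<in> ?B"
    using e by simp
  from leibniz_rule[OF der int cont' this convex_ball]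
  have "((\<lambda>x. integral (cbox (- a) a) (\<lambda>y. bump (N0 x y))) has_derivative
      integral (cbox (- a) a) (bump_N0_derivative x0)) (at x0 within ?B)"
    by blast
  then have "(\<lambda>x. integral (cbox (- a) a) (\<lambda>y. bump (N0 x y))) differentiable (at x0)"
    using e by (auto simp: differentiable_def at_within_open[of x0 ?B])
  then show ?thesis
    by (rule differentiable_transform_open[of _ _ ?B]) (use e integral_bump_restrict[OF supp] in auto)
qed

lemma integral_bump_pos:
  assumes x: "x \<in> U"
  shows "integral UNIV (\<lambda>y. bump (N0 x y)) > 0"
proof -
  obtain a where a: "{y. N0 x y < 2} \<subseteq> box (- a) a"
    using bounded_subset_box_symmetric[OF bounded_sublevel[OF x]] by metis
  define u :: "real ^ 'n" where "u = axis undefined 1"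
  (* The vector on the ray of u at which N0 has the value 3 / 2, inside the support of the bump. *)
  define y where "y = (3 / (2 * N0 x u)) *\<^sub>R u"
  have u: "u \<noteq> 0"
    by (simp add: u_def axis_eq_0_iff)
  then have Nu: "N0 x u > 0"
    using pos[OF x] by (simp add: N0_def)
  then have "N0 x y = 3 / 2"
    using hom[OF x u, of "3 / (2 * N0 x u)"] u by (simp add: N0_def y_def)
  then have "bump (N0 x y) \<noteq> 0" "y \<in> box (- a) a"
    using a by (auto simp: bump_def)
  then have y: "bump (N0 x y) \<noteq> 0" "y \<in> cbox (- a) a" "box (- a) a \<noteq> {}"
    using box_subset_cbox[of "- a" a] by auto
  have "integral (cbox (- a) a) (\<lambda>y. bump (N0 x y)) \<noteq> 0"
    using y integral_cbox_eq_0_iff[OF continuous_on_subset[OF continuous_bump_N0[OF x]] y(3)]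
    by (auto simp: bump_bounds)
  moreover have "integral (cbox (- a) a) (\<lambda>y. bump (N0 x y)) \<ge> 0"
    by (intro integral_nonneg integrable_continuous continuous_on_subset[OF continuous_bump_N0[OF x]])
      (auto simp: bump_bounds)
  ultimately show ?thesis
    using a box_subset_cbox[of "- a" a] integral_bump_restrict[of x "cbox (- a) a"] by auto
qed

lemma volume_differentiable:
  assumes x0: "x0 \<in> U"
  shows "(\<lambda>x. measure lebesgue (unit_ball N x)) differentiable (at x0)"
proof -
  define C where "C = measure lebesgue (unit_ball N x0) / integral UNIV (\<lambda>y. bump (N0 x0 y))"
  have "(\<lambda>x. C * integral UNIV (\<lambda>y. bump (N0 x y))) differentiable (at x0)"
    by (intro differentiable_mult integral_bump_differentiable x0) auto
  then show ?thesis
    by (rule differentiable_transform_open[OF _ open_U x0])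
      (use volume_proportional[OF _ x0] integral_bump_pos[OF x0] in \<open>simp add: C_def field_simps\<close>)
qed

end

section \<open>The distortion in coordinates\<close>

context local_finsler
begin

lemma distortion_of_differentiable:
  assumes "z \<in> slit"
  shows "distortion_of N differentiable (at z)"
proof -
  let ?V = "\<lambda>z. measure lebesgue (unit_ball N (fst z))"
  let ?b = "measure lebesgue (ball 0 1 :: (real ^ 'n) set)"
  obtain x y where z: "z = (x, y)" "x \<in> U" "y \<noteq> 0"
    using assms by auto
  have det: "det (metric_tensor N z) > 0"
    using det_metric_tensor_pos z by simp
  have V: "?V z > 0"
    using measure_unit_ball_pos z by simp
  have b: "?b > 0"
    using content_ball_pos[of 1 0] by simp
  obtain D where D: "((\<lambda>z. det (metric_tensor N z)) has_derivative D) (at z)"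
    using det_metric_tensor_differentiable[OF assms] by (auto simp: differentiable_def)
  obtain E where "((\<lambda>x. measure lebesgue (unit_ball N x)) has_derivative E) (at (fst z))"
    using volume_differentiable z by (auto simp: differentiable_def)
  from has_derivative_compose[OF has_derivative_fst[OF has_derivative_ident] this]
  have E: "(?V has_derivative (\<lambda>v. E (fst v))) (at z)" .
  have "(\<lambda>z. ln (sqrt (det (metric_tensor N z)) * ?V z / ?b)) differentiable (at z)"
    unfolding differentiable_def
    using det V b by (intro exI) (rule derivative_eq_intros D E refl | simp)+
  then show ?thesis
    by (simp add: distortion_of_def[abs_def])
qed

lemma distortion_of_scale:
  assumes "x \<in> U" "y \<noteq> 0" "r > 0"
  shows "distortion_of N (x, r *\<^sub>R y) = distortion_of N (x, y)"
  using metric_tensor_scale[OF assms] by (simp add: distortion_of_def)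

text \<open>
  By scale invariance it is enough to maximize over the Euclidean unit sphere.
\<close>

lemma distortion_of_attains_max:
  assumes x: "x \<in> U"
  obtains y0 where "y0 \<noteq> 0" "\<And>y. y \<noteq> 0 \<Longrightarrow> distortion_of N (x, y) \<le> distortion_of N (x, y0)"
proof -
  let ?S = "sphere (0 :: real ^ 'n) 1"
  have "axis undefined 1 \<in> ?S"
    by simp
  then have ne: "?S \<noteq> {}"
    by blast
  have "continuous_on slit (distortion_of N)"
    using distortion_of_differentiable
    by (meson continuous_at_imp_continuous_on differentiable_imp_continuous_within)
  then have "continuous_on ?S (\<lambda>y. distortion_of N (x, y))"
    by (rule continuous_on_compose2) (use x in \<open>auto intro!: continuous_intros\<close>)
  then obtain y0 where y0: "y0 \<in> ?S" "\<And>y. y \<in> ?S \<Longrightarrow> distortion_of N (x, y) \<le> distortion_of N (x, y0)"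
    using continuous_attains_sup[OF compact_sphere ne] by blast
  show ?thesis
  proof
    show "y0 \<noteq> 0"
      using y0(1) by auto
    fix y :: "real ^ 'n" assume y: "y \<noteq> 0"
    have "distortion_of N (x, y) = distortion_of N (x, y /\<^sub>R norm y)"
      using distortion_of_scale[OF x y, of "inverse (norm y)"] y by simp
    also have "\<dots> \<le> distortion_of N (x, y0)"
      using y by (intro y0) simp
    finally show "distortion_of N (x, y) \<le> distortion_of N (x, y0)" .
  qed
qed

text \<open>
  If \<open>L y = 0\<close>, then \<open>N (x, r *\<^sub>R y) = N (x', 0)\<close> for all \<open>r > 0\<close>, but homogeneity and positivity
  make the left-hand side depend on \<open>r\<close>.
\<close>

lemma linear_isometry_nonzero:
  assumes x: "x \<in> U" and L: "linear L"
    and eq: "\<And>y. y \<noteq> 0 \<Longrightarrow> N (x, y) = N (x', L y)" and y: "y \<noteq> 0"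
  shows "L y \<noteq> 0"
proof
  assume "L y = 0"
  then have "N (x, 2 *\<^sub>R y) = N (x, y)"
    using eq[of "2 *\<^sub>R y"] eq[OF y] y by (simp add: linear_cmul[OF L])
  then show False
    using hom[OF x y, of 2] pos[OF x y] by simp
qed

text \<open>
  Under \<open>L\<close> the square root of the determinant of the fundamental tensor and the volume of the unit ball
  change by inverse factors.
\<close>

lemma distortion_of_linear_isometry:
  assumes x: "x \<in> U" and x': "x' \<in> U" and L: "linear L"
    and eq: "\<And>y. y \<noteq> 0 \<Longrightarrow> N (x, y) = N (x', L y)" and y: "y \<noteq> 0"
  shows "distortion_of N (x, y) = distortion_of N (x', L y)"
proof -
  have nz: "L y \<noteq> 0" if "y \<noteq> 0" for y
    by (rule linear_isometry_nonzero[OF x L eq that])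
  then have inj: "inj L"
    using linear_injective_0[OF L] by blast
  then have surj: "surj L"
    using L linear_injective_imp_surjective by blast
  have det_nz: "det (matrix L) \<noteq> 0"
    using inj det_nz_iff_inj[OF L] by blast
  have "det (metric_tensor N (x, y)) = (det (matrix L))\<^sup>2 * det (metric_tensor N (x', L y))"
    by (simp add: metric_tensor_linear_change[OF x x' L nz eq y] det_mul power2_eq_square mult_ac)
  then have det: "sqrt (det (metric_tensor N (x, y))) = \<bar>det (matrix L)\<bar> * sqrt (det (metric_tensor N (x', L y)))"
    by (simp add: real_sqrt_mult)
  have "unit_ball N x' \<subseteq> L ` unit_ball N x"
  proof
    fix w assume w: "w \<in> unit_ball N x'"
    obtain u where u: "w = L u"
      using surj by (metis surjD)
    then show "w \<in> L ` unit_ball N x"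
      using w nz eq[of u] by (cases "u = 0") (auto simp: unit_ball_def)
  qed
  moreover have "L ` unit_ball N x \<subseteq> unit_ball N x'"
  proof (rule image_subsetI)
    show "L u \<in> unit_ball N x'" if "u \<in> unit_ball N x" for u
      using that eq[of u] linear_0[OF L] by (cases "u = 0") (auto simp: unit_ball_def)
  qed
  ultimately have "measure lebesgue (unit_ball N x') = \<bar>det (matrix L)\<bar> * measure lebesgue (unit_ball N x)"
    using lmeasurable_measure_linear_image[OF L unit_ball_lmeasurable[OF x]] by simp
  then show ?thesis
    using det det_nz by (simp add: distortion_of_def mult_ac)
qed

end

section \<open>Charts and tangent vectors\<close>

locale manifold =
  fixes X :: "'a topology" and A :: "('a, 'n::finite) chart set"
  assumes smooth_manifold: "smooth_manifold X A"
begin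

lemma chart_subset: "c \<in> A \<Longrightarrow> fst c \<subseteq> topspace X"
  using smooth_manifold by (auto simp: smooth_manifold_def)

lemma openin_chart: "c \<in> A \<Longrightarrow> openin X (fst c)"
  using smooth_manifold by (auto simp: smooth_manifold_def is_chart_def)

lemma open_chart_image: "c \<in> A \<Longrightarrow> open (snd c ` fst c)"
  using smooth_manifold by (auto simp: smooth_manifold_def is_chart_def)

lemma homeomorphic_chart:
  "c \<in> A \<Longrightarrow> homeomorphic_map (subtopology X (fst c)) (top_of_set (snd c ` fst c)) (snd c)"
  using smooth_manifold by (auto simp: smooth_manifold_def is_chart_def)

lemma inj_on_chart:
  assumes "c \<in> A"
  shows "inj_on (snd c) (fst c)"
  using homeomorphic_imp_injective_map[OF homeomorphic_chart[OF assms]] chart_subset[OF assms]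
  by (simp add: Int_absorb1)

lemma chart_inv_chart: "c \<in> A \<Longrightarrow> p \<in> fst c \<Longrightarrow> chart_inv c (snd c p) = p"
  by (simp add: inj_on_chart)

lemma open_chart_image_of_open:
  assumes c: "c \<in> A" and W: "openin X W" "W \<subseteq> fst c"
  shows "open (snd c ` W)"
proof -
  have "openin (subtopology X (fst c)) W"
    using W by (simp add: openin_subset_topspace_eq openin_subtopology_Int2 subset_openin_subtopology)
  then have "openin (top_of_set (snd c ` fst c)) (snd c ` W)"
    using homeomorphic_imp_open_map[OF homeomorphic_chart[OF c]] by (simp add: open_map_def)
  then show ?thesis
    using openin_open_eq[OF open_chart_image[OF c]] by blast
qed

lemma chart_at_in_charts_at:
  assumes "p \<in> topspace X"
  shows "chart_at A p \<in> charts_at A p"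
proof -
  have "p \<in> (\<Union>c\<in>A. fst c)"
    using assms smooth_manifold unfolding smooth_manifold_def by blast
  then have "\<exists>c. c \<in> charts_at A p"
    unfolding charts_at_def by blast
  then show ?thesis
    unfolding chart_at_def by (rule someI_ex)
qed

lemma differentiable_smooth_on: "smooth_on S f \<Longrightarrow> x \<in> S \<Longrightarrow> f differentiable (at x)"
  unfolding smooth_on_def using Ck_on.simps(2)[of 0 S f] by blast

lemma coordinate_change_differentiable:
  assumes "c \<in> A" "d \<in> A" "p \<in> fst c" "p \<in> fst d"
  shows "(snd d \<circ> chart_inv c) differentiable (at (snd c p))"
proof (rule differentiable_smooth_on)
  show "smooth_on (snd c ` (fst c \<inter> fst d)) (snd d \<circ> chart_inv c)"
    using smooth_manifold assms by (auto simp: smooth_manifold_def)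
qed (use assms in auto)

text \<open>
  The chain rule for \<open>h \<circ> g\<close> with the chart \<open>e\<close> inserted in between. The factorization through \<open>e\<close> is valid
  only near the point, on the image of the open set \<open>W\<close>.
\<close>

lemma chain_rule_in_chart:
  assumes c: "c \<in> A" and e: "e \<in> A" and W: "openin X W" "W \<subseteq> fst c" "q \<in> W"
    and g: "\<And>p. p \<in> W \<Longrightarrow> g p \<in> fst e"
    and diff_g: "(snd e \<circ> g \<circ> chart_inv c) differentiable (at (snd c q))"
    and diff_h: "(h \<circ> chart_inv e) differentiable (at (snd e (g q)))"
  shows "frechet_derivative (h \<circ> g \<circ> chart_inv c) (at (snd c q)) =
    frechet_derivative (h \<circ> chart_inv e) (at (snd e (g q))) \<circ>
    frechet_derivative (snd e \<circ> g \<circ> chart_inv c) (at (snd c q))"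
proof -
  let ?k = "(h \<circ> chart_inv e) \<circ> (snd e \<circ> g \<circ> chart_inv c)"
  have q: "chart_inv c (snd c q) = q"
    using c W by (intro chart_inv_chart) auto
  have diff_h': "(h \<circ> chart_inv e) differentiable (at ((snd e \<circ> g \<circ> chart_inv c) (snd c q)))"
    using diff_h by (simp add: q)
  have "?k x = (h \<circ> g \<circ> chart_inv c) x" if x: "x \<in> snd c ` W" for x
  proof -
    obtain p where p: "x = snd c p" "p \<in> W"
      using x by blast
    then have "chart_inv c x = p"
      using c W by (auto intro: chart_inv_chart)
    then show ?thesis
      using chart_inv_chart[OF e g[OF p(2)]] by simp
  qed
  then have "frechet_derivative ?k (at (snd c q)) = frechet_derivative (h \<circ> g \<circ> chart_inv c) (at (snd c q))"
    using open_chart_image_of_open[OF c W(1,2)] W(3)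
    by (intro frechet_derivative_transform_within_open[of _ _ "snd c ` W"] differentiable_chain_at diff_g diff_h') auto
  moreover have "(snd e \<circ> g \<circ> chart_inv c) (snd c q) = snd e (g q)"
    by (simp add: q)
  ultimately show ?thesis
    using frechet_derivative_compose[OF diff_g diff_h'] by (simp only:)
qed

text \<open>
  This makes a coordinate vector a tangent vector, independently of the chart that it comes from.
\<close>

lemma coordinate_change_cocycle:
  assumes "c \<in> A" "d \<in> A" "e \<in> A" "p \<in> fst c" "p \<in> fst d" "p \<in> fst e"
  shows "frechet_derivative (snd d \<circ> chart_inv c) (at (snd c p)) y =
    frechet_derivative (snd d \<circ> chart_inv e) (at (snd e p))
      (frechet_derivative (snd e \<circ> chart_inv c) (at (snd c p)) y)"
proof -
  have "frechet_derivative (snd d \<circ> id \<circ> chart_inv c) (at (snd c p)) =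
    frechet_derivative (snd d \<circ> chart_inv e) (at (snd e (id p))) \<circ>
    frechet_derivative (snd e \<circ> id \<circ> chart_inv c) (at (snd c p))"
  proof (rule chain_rule_in_chart[of c e "fst c \<inter> fst e"])
    show "openin X (fst c \<inter> fst e)"
      using assms by (intro openin_Int openin_chart)
  qed (use assms coordinate_change_differentiable in auto)
  then show ?thesis
    by simp
qed

lemma frechet_derivative_chart_id:
  assumes "c \<in> A" "p \<in> fst c"
  shows "frechet_derivative (snd c \<circ> chart_inv c) (at (snd c p)) y = y"
proof -
  have "frechet_derivative (\<lambda>x. x) (at (snd c p)) = frechet_derivative (snd c \<circ> chart_inv c) (at (snd c p))"
    by (rule frechet_derivative_transform_within_open[of _ _ "snd c ` fst c"])
      (use assms open_chart_image in \<open>auto simp: f_inv_into_f\<close>)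
  then show ?thesis
    by (metis frechet_derivative_ident)
qed

lemma coord_vector_self: "c \<in> charts_at A p \<Longrightarrow> coord_vector A c p y c = y"
  by (simp add: coord_vector_def charts_at_def frechet_derivative_chart_id)

lemma coord_vector_in_tangent_space:
  assumes "c \<in> charts_at A p"
  shows "coord_vector A c p y \<in> tangent_space A p"
  unfolding tangent_space_def mem_Collect_eq
proof (intro conjI ballI allI impI)
  fix b d
  assume bd: "b \<in> charts_at A p" "d \<in> charts_at A p"
  then have "coord_vector A c p y d = frechet_derivative (snd d \<circ> chart_inv c) (at (snd c p)) y"
    and "coord_vector A c p y b = frechet_derivative (snd b \<circ> chart_inv c) (at (snd c p)) y"
    by (simp_all add: coord_vector_def)
  then show "coord_vector A c p y d =
      frechet_derivative (snd d \<circ> chart_inv b) (at (snd b p)) (coord_vector A c p y b)"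
    using coordinate_change_cocycle[of c d b p y] assms bd by (simp only: charts_at_def mem_Collect_eq)
qed (simp add: coord_vector_def)

lemma coord_vector_nonzero:
  assumes "c \<in> charts_at A p" "y \<noteq> 0"
  shows "coord_vector A c p y \<noteq> (\<lambda>_. 0)"
  using coord_vector_self[OF assms(1), of y] assms(2) by metis

lemma coord_vector_scale:
  assumes "c \<in> charts_at A p"
  shows "coord_vector A c p (r *\<^sub>R y) = (\<lambda>d. r *\<^sub>R coord_vector A c p y d)"
proof
  fix d
  have "linear (frechet_derivative (snd d \<circ> chart_inv c) (at (snd c p)))" if "d \<in> charts_at A p"
    using that assms by (intro linear_frechet_derivative coordinate_change_differentiable) (auto simp: charts_at_def)
  then show "coord_vector A c p (r *\<^sub>R y) d = r *\<^sub>R coord_vector A c p y d"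
    by (auto simp: coord_vector_def linear_cmul)
qed

lemma local_finsler_of_chart:
  assumes F: "finsler_metric X A F" and c: "c \<in> A"
  shows "local_finsler (snd c ` fst c) (local_F A F c)"
proof
  show "open (snd c ` fst c)"
    using c by (rule open_chart_image)
  show "smooth_on (snd c ` fst c \<times> (UNIV - {0})) (local_F A F c)"
    using F c by (auto simp: finsler_metric_def)
  fix x and y :: "real ^ 'n"
  assume x: "x \<in> snd c ` fst c" and y: "y \<noteq> 0"
  define p where "p = chart_inv c x"
  have p: "c \<in> charts_at A p" "p \<in> topspace X"
    using x c chart_subset[OF c] by (auto simp: p_def charts_at_def inv_into_into)
  then have v: "coord_vector A c p y \<in> tangent_space A p - {\<lambda>_. 0}"
    using coord_vector_in_tangent_space coord_vector_nonzero y by auto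
  show "local_F A F c (x, y) > 0"
    using F p v by (auto simp: finsler_metric_def local_F_def p_def)
  show "local_F A F c (x, r *\<^sub>R y) = r * local_F A F c (x, y)" if "r > 0" for r
    using F p v that by (simp add: finsler_metric_def local_F_def p_def[symmetric] coord_vector_scale)
  have "local_F2 A F c = (\<lambda>z. (local_F A F c z)\<^sup>2)"
    by (simp add: fun_eq_iff local_F2_def)
  then have "metric_tensor (local_F A F c) z = fundamental_tensor A F c z" for z
    by (simp add: metric_tensor_def fundamental_tensor_def)
  then show "u \<bullet> (metric_tensor (local_F A F c) (x, y) *v u) > 0" if "u \<noteq> 0" for u
    using F c x y that unfolding finsler_metric_def by metis
qed

end

section \<open>Homogeneous Finsler spaces\<close>

context manifold
begin

text \<open>
  The map \<open>L\<close> is the Jacobian of \<open>f\<close> in the chart \<open>c\<close>. The differential of \<open>f\<close> is defined by means of an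
  arbitrary chart \<open>e\<close> at \<open>q\<close>, so it has to be translated to \<open>c\<close> by the chain rule.
\<close>

lemma isometry_local_F:
  assumes f: "f \<in> isometry_group X A F" and c: "c \<in> A" and q: "q \<in> fst c" "f q \<in> fst c"
  obtains L where "linear L"
    "\<And>y. y \<noteq> 0 \<Longrightarrow> local_F A F c (snd c q, y) = local_F A F c (snd c (f q), L y)"
proof -
  have hom: "homeomorphic_map X X f" and sm: "smooth_map A f"
    and iso: "\<And>p v. p \<in> topspace X \<Longrightarrow> v \<in> tangent_space A p - {\<lambda>_. 0} \<Longrightarrow>
      F (f p) (differential A f p v) = F p v"
    using f by (auto simp: isometry_group_def diffeomorphism_def)
  have qX: "q \<in> topspace X"
    using q chart_subset[OF c] by blast
  define e where "e = chart_at A q"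
  have e: "e \<in> A" "q \<in> fst e"
    using chart_at_in_charts_at[OF qX] by (auto simp: e_def charts_at_def)
  have f_diff: "(snd d \<circ> f \<circ> chart_inv b) differentiable (at (snd b q))"
    if "b \<in> A" "d \<in> A" "q \<in> fst b" "f q \<in> fst d" for b d
  proof (rule differentiable_smooth_on)
    show "smooth_on (snd b ` {p \<in> fst b. f p \<in> fst d}) (snd d \<circ> f \<circ> chart_inv b)"
      using sm that by (auto simp: smooth_map_def)
  qed (use that in auto)
  define L where "L = frechet_derivative (snd c \<circ> f \<circ> chart_inv c) (at (snd c q))"
  have "linear L"
    unfolding L_def using c q by (intro linear_frechet_derivative f_diff)
  moreover have "local_F A F c (snd c q, y) = local_F A F c (snd c (f q), L y)" if y: "y \<noteq> 0" for y
  proof -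
    let ?v = "coord_vector A c q y"
    have cq: "c \<in> charts_at A q" "c \<in> charts_at A (f q)"
      using c q by (auto simp: charts_at_def)
    have "differential A f q ?v d = coord_vector A c (f q) (L y) d" for d
    proof (cases "d \<in> charts_at A (f q)")
      case True
      then have d: "d \<in> A" "f q \<in> fst d"
        by (auto simp: charts_at_def)
      have "differential A f q ?v d = frechet_derivative (snd d \<circ> f \<circ> chart_inv e) (at (snd e q))
          (frechet_derivative (snd e \<circ> chart_inv c) (at (snd c q)) y)"
        using True e by (simp add: differential_def e_def[symmetric] coord_vector_def charts_at_def)
      also have "\<dots> = frechet_derivative (snd d \<circ> f \<circ> chart_inv c) (at (snd c q)) y"
      proof -
        have "frechet_derivative (snd d \<circ> f \<circ> id \<circ> chart_inv c) (at (snd c q)) =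
          frechet_derivative (snd d \<circ> f \<circ> chart_inv e) (at (snd e (id q))) \<circ>
          frechet_derivative (snd e \<circ> id \<circ> chart_inv c) (at (snd c q))"
        proof (rule chain_rule_in_chart[of c e "fst c \<inter> fst e"])
          show "openin X (fst c \<inter> fst e)"
            using c e by (intro openin_Int openin_chart)
        qed (use c e q d coordinate_change_differentiable[of c e q] f_diff[of e d] in auto)
        then show ?thesis
          by simp
      qed
      also have "\<dots> = frechet_derivative (snd d \<circ> chart_inv c) (at (snd c (f q))) (L y)"
      proof -
        (* The chain rule goes through the chart c at f q, so the points near q must stay in its domain. *)
        let ?W = "fst c \<inter> {p \<in> topspace X. f p \<in> fst c}"
        have "openin X ?W"
          using openin_continuous_map_preimage[OF homeomorphic_imp_continuous_map[OF hom] openin_chart[OF c]]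
            openin_chart[OF c] by blast
        then have "frechet_derivative (snd d \<circ> f \<circ> chart_inv c) (at (snd c q)) =
          frechet_derivative (snd d \<circ> chart_inv c) (at (snd c (f q))) \<circ> L"
          unfolding L_def
          by (rule chain_rule_in_chart[OF c c])
            (use c d q qX f_diff[of c c] coordinate_change_differentiable[of c d "f q"] in auto)
        then show ?thesis
          by simp
      qed
      finally show ?thesis
        using True by (simp add: coord_vector_def)
    qed (simp add: differential_def coord_vector_def)
    then have "differential A f q ?v = coord_vector A c (f q) (L y)"
      by (rule ext)
    moreover have "?v \<in> tangent_space A q - {\<lambda>_. 0}"
      using cq coord_vector_in_tangent_space coord_vector_nonzero y by auto
    ultimately have "F (f q) (coord_vector A c (f q) (L y)) = F q ?v"
      using iso[OF qX] by metis
    then show ?thesis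
      using c q by (simp add: local_F_def chart_inv_chart)
  qed
  ultimately show ?thesis
    by (rule that)
qed

text \<open>
  The vector \<open>v\<close> maximizes the distortion on the tangent space at \<open>p\<close>, hence on the whole slit tangent
  bundle, by transitivity of the isometry group. It is a critical point of the distortion.
\<close>

lemma ex_zero_S_curvature:
  assumes F: "finsler_metric X A F" and homogeneous: "homogeneous_finsler X A F" and p: "p \<in> topspace X"
  obtains v where "v \<in> tangent_space A p - {\<lambda>_. 0}" "S_curvature A F p v = 0"
proof -
  define c where "c = chart_at A p"
  have cp: "c \<in> charts_at A p"
    using chart_at_in_charts_at[OF p] by (simp add: c_def)
  then have c: "c \<in> A" "p \<in> fst c"
    by (auto simp: charts_at_def)
  interpret local_finsler "snd c ` fst c" "local_F A F c"
    by (rule local_finsler_of_chart[OF F c(1)])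
  let ?\<tau> = "distortion_of (local_F A F c)"
  obtain y0 where y0: "y0 \<noteq> 0" "\<And>y. y \<noteq> 0 \<Longrightarrow> ?\<tau> (snd c p, y) \<le> ?\<tau> (snd c p, y0)"
    using distortion_of_attains_max[of "snd c p"] c(2) by blast
  have z0: "(snd c p, y0) \<in> slit"
    using c y0(1) by auto
  have max: "?\<tau> z \<le> ?\<tau> (snd c p, y0)" if "z \<in> slit" for z
  proof -
    obtain q y where z: "z = (snd c q, y)" "q \<in> fst c" "y \<noteq> 0"
      using \<open>z \<in> slit\<close> by auto
    then have "q \<in> topspace X"
      using chart_subset[OF c(1)] by blast
    with homogeneous p obtain f where f: "f \<in> isometry_group X A F" "f q = p"
      unfolding homogeneous_finsler_def by blast
    obtain L where L: "linear L"
      "\<And>y. y \<noteq> 0 \<Longrightarrow> local_F A F c (snd c q, y) = local_F A F c (snd c p, L y)"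
      using isometry_local_F[OF f(1) c(1) z(2), unfolded f(2), OF c(2)] by blast
    have "?\<tau> z = ?\<tau> (snd c p, L y)"
      unfolding z(1) using z(2,3) c(2) by (intro distortion_of_linear_isometry L) auto
    also have "\<dots> \<le> ?\<tau> (snd c p, y0)"
      using z(2,3) by (intro y0(2) linear_isometry_nonzero[OF _ L]) auto
    finally show ?thesis .
  qed
  have "(?\<tau> has_derivative frechet_derivative ?\<tau> (at (snd c p, y0))) (at (snd c p, y0))"
    using distortion_of_differentiable[OF z0] by (simp add: frechet_derivative_works)
  then have "frechet_derivative ?\<tau> (at (snd c p, y0)) = (\<lambda>v. 0)"
    using differential_zero_maxmin[OF z0 open_slit] max by blast
  then have "S_curvature A F p (coord_vector A c p y0) = 0"
    by (simp add: S_curvature_def Let_def c_def[symmetric] coord_vector_self[OF cp] distortion_eq)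
  then show ?thesis
    using that coord_vector_in_tangent_space[OF cp] coord_vector_nonzero[OF cp y0(1)] by blast
qed

end

theorem corollary4p3:
  fixes X :: "'a topology"
    and A :: "('a, 'n::finite) chart set"
    and F :: "'a \<Rightarrow> ('a, 'n) tangent \<Rightarrow> real"
  assumes "smooth_manifold X A"
    and "connected_space X"
    and "finsler_metric X A F"
    and "homogeneous_finsler X A F"
  shows "isotropic_S_curvature X A F \<longleftrightarrow> vanishing_S_curvature X A F"
proof
  interpret manifold X A
    by (rule manifold.intro[OF assms(1)])
  assume "isotropic_S_curvature X A F"
  then obtain \<kappa> where \<kappa>: "\<And>p v. p \<in> topspace X \<Longrightarrow> v \<in> tangent_space A p - {\<lambda>_. 0} \<Longrightarrow>
      S_curvature A F p v = (real CARD('n) + 1) * \<kappa> p * F p v"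
    unfolding isotropic_S_curvature_def by blast
  have "\<kappa> p = 0" if p: "p \<in> topspace X" for p
  proof -
    obtain v where v: "v \<in> tangent_space A p - {\<lambda>_. 0}" "S_curvature A F p v = 0"
      using ex_zero_S_curvature[OF assms(3,4) p] .
    have "F p v > 0"
      using assms(3) p v(1) by (auto simp: finsler_metric_def)
    then show ?thesis
      using \<kappa>[OF p v(1)] v(2) by (auto simp: add_nonneg_eq_0_iff)
  qed
  then show "vanishing_S_curvature X A F"
    using \<kappa> by (simp add: vanishing_S_curvature_def)
next
  assume "vanishing_S_curvature X A F"
  then show "isotropic_S_curvature X A F"
    unfolding isotropic_S_curvature_def vanishing_S_curvature_def
    by (intro exI[of _ "\<lambda>_. 0"]) simp
qed

end
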